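(* Consider the asymmetric (resp. symmetric) case of the measurement model $y=\mathcal{A}(M_* )+\xi$ described in the context. Let $r\ge r_*:=\operatorname{rank}(M_* )$, and suppose that $\mathcal{A}$ satisfies the following for some $\beta\ge\alpha>0$: 1. (Restricted lower isometry on error) for all $M\in\mathbf{R}^{d_1\times d_2}$ (resp. $M\in\mathbf{S}_d^+$) with rank at most $r$, $\|\mathcal{A}(M-M_* )\|^2\ge\alpha\|M-M_*\|_{\mathrm F}^2$; 2. (Tangent space upper isometry) for all $H\in\mathcal{T}$, $\|\mathcal{A}(H)\|^2\le\beta\|H\|_{\mathrm F}^2$. If $$\frac{\beta}{\alpha}<\frac{6}{\sqrt5+2},$$ then, for every $\lambda\ge0$, every second-order critical point $(U,V)$ of problem (P) with $M:=UV^\top$ (resp. every second-order critical point $U$ of problem (P-sym) with $M:=UU^\top$) satisfies $$\|M-M_*\|_{\mathrm F}\le\frac{(36\lambda+12\|\mathcal{A}^*(\xi)\|_{\mathrm{op}})\sqrt{r_*}+10\sqrt{r+r_*}\,(\|\mathcal{A}^*(\xi)\|_{\mathrm{op}}-\lambda)_+}{6\alpha-(\sqrt5+2)\beta}.$$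
   Context: Notation: $\langle\cdot,\cdot\rangle$ is the standard (trace) inner product, $\|\cdot\|$ the Euclidean norm on $\mathbf{R}^n$, $\|\cdot\|_{\mathrm F}$ the Frobenius norm, $\|\cdot\|_{\mathrm{op}}$ the ($\ell_2$) operator norm, and $x_+=\max\{x,0\}$. $\mathbf{S}_d$ is the set of real symmetric $d\times d$ matrices and $\mathbf{S}_d^+\subseteq\mathbf{S}_d$ the set of positive semidefinite ones. Asymmetric case: $M_*\in\mathbf{R}^{d_1\times d_2}$, $A_1,\dots,A_n\in\mathbf{R}^{d_1\times d_2}$, $\xi\in\mathbf{R}^n$; $\mathcal{A}:\mathbf{R}^{d_1\times d_2}\to\mathbf{R}^n$ is the linear operator $\mathcal{A}(M)_i=\langle A_i,M\rangle$, $\mathcal{A}^*$ is its adjoint, and $y=\mathcal{A}(M_* )+\xi$. For an integer $r\ge1$ and $\lambda\ge0$, problem (P) is $$\min_{U\in\mathbf{R}^{d_1\times r},\,V\in\mathbf{R}^{d_2\times r}}\ \tfrac12\|\mathcal{A}(UV^\top)-y\|^2+\lambda\,\frac{\|U\|_{\mathrm F}^2+\|V\|_{\mathrm F}^2}{2}.$$ Symmetric case: $d_1=d_2=d$, and furthermore $M_*\in\mathbf{S}_d^+$ and $A_1,\dots,A_n\in\mathbf{S}_d$; otherwise $\mathcal{A},\xi,y$ are as before. Problem (P-sym) is $$\min_{U\in\mathbf{R}^{d\times r}}\ \tfrac12\|\mathcal{A}(UU^\top)-y\|^2+\lambda\|U\|_{\mathrm F}^2.$$ A second-order critical point is a point at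 which the gradient of the objective is zero and the Hessian is positive semidefinite. The tangent space to $M_*$ is the linear subspace $\mathcal{T}=\{LM_*+M_*R^\top: L\in\mathbf{R}^{d_1\times d_1},R\in\mathbf{R}^{d_2\times d_2}\}\subseteq\mathbf{R}^{d_1\times d_2}$; in the symmetric case one additionally requires $L=R$, so that $\mathcal{T}=\{LM_*+M_*L^\top:L\in\mathbf{R}^{d\times d}\}\subseteq\mathbf{S}_d$. *)

theory Defs
  imports "HOL-Analysis.Analysis"
begin

text \<open>
  The type \<open>real^'c^'b\<close> consists of the matrices with rows indexed by \<open>'b\<close> and columns
  indexed by \<open>'c\<close>.  On it the library's \<open>inner\<close> is the trace inner product and \<open>norm\<close> is the
  Frobenius norm.
\<close>

definition op_norm :: "real^'c^'b \<Rightarrow> real" where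
  "op_norm M = onorm ((*v) M)"

definition psd_matrices :: "(real^'d^'d) set" where
  "psd_matrices = {M. transpose M = M \<and> (\<forall>x. 0 \<le> x \<bullet> (M *v x))}"

definition meas_op :: "('n \<Rightarrow> real^'c^'b) \<Rightarrow> real^'c^'b \<Rightarrow> real^'n" where
  "meas_op A M = (\<chi> i. A i \<bullet> M)"

definition objective ::
  "('n::finite \<Rightarrow> real^'c^'b) \<Rightarrow> real^'n \<Rightarrow> real \<Rightarrow> (real^'r^'b) \<times> (real^'r^'c) \<Rightarrow> real" where
  "objective A y lam = (\<lambda>(U, V).
     1/2 * (norm (meas_op A (U ** transpose V) - y))\<^sup>2
       + lam * (((norm U)\<^sup>2 + (norm V)\<^sup>2) / 2))"

definition objective_sym ::
  "('n::finite \<Rightarrow> real^'d^'d) \<Rightarrow> real^'n \<Rightarrow> real \<Rightarrow> real^'r^'d \<Rightarrow> real" where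
  "objective_sym A y lam U =
     1/2 * (norm (meas_op A (U ** transpose U) - y))\<^sup>2 + lam * (norm U)\<^sup>2"

text \<open>
  Here \<open>g\<close> is the gradient field of \<open>f\<close> near \<open>x\<close> and the linear map \<open>H\<close>, the derivative of \<open>g\<close>
  at \<open>x\<close>, is the Hessian of \<open>f\<close> at \<open>x\<close>.
\<close>

definition second_order_critical_point :: "('a::euclidean_space \<Rightarrow> real) \<Rightarrow> 'a \<Rightarrow> bool" where
  "second_order_critical_point f x \<longleftrightarrow>
     (\<exists>g H. (\<forall>\<^sub>F z in nhds x. GDERIV f z :> g z) \<and> (g has_derivative H) (at x) \<and>
            g x = 0 \<and> (\<forall>h. 0 \<le> h \<bullet> H h))"

definition tangent_space :: "real^'c^'b \<Rightarrow> (real^'c^'b) set" where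
  "tangent_space M = {L ** M + M ** transpose R | (L :: real^'b^'b) (R :: real^'c^'c). True}"

definition tangent_space_sym :: "real^'d^'d \<Rightarrow> (real^'d^'d) set" where
  "tangent_space_sym M = {L ** M + M ** transpose L | L :: real^'d^'d. True}"

end

theory Submission
  imports Defs
begin

text \<open>
  Write \<open>M = U V\<^sup>T\<close>, let \<open>E = M - M\<^sub>0\<close> be the error with respect to the true matrix \<open>M\<^sub>0\<close>, let
  \<open>f\<close> be the measurement operator, \<open>\<lambda>\<close> the regularisation parameter and \<open>\<Xi> = f\<^sup>*\<xi>\<close>. Factor
  \<open>M\<^sub>0 = D\<^sub>1 D\<^sub>2\<^sup>T\<close> with \<open>D\<^sub>1\<^sup>T D\<^sub>1 = D\<^sub>2\<^sup>T D\<^sub>2\<close> and move from \<open>(U, V)\<close> in the direction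
  \<open>(D\<^sub>1 - U, D\<^sub>2 - V)\<close>. The first-order change of \<open>U V\<^sup>T\<close> is \<open>W - 2 E\<close>, where
  \<open>W = U D\<^sub>2\<^sup>T + D\<^sub>1 V\<^sup>T - 2 M\<^sub>0\<close> lies in the tangent space of \<open>M\<^sub>0\<close>. Expanding \<open>\<parallel>f(W - 2 E)\<parallel>\<^sup>2\<close>
  in the second-order condition produces, besides \<open>\<parallel>f W\<parallel>\<^sup>2\<close>, only terms that the first-order
  condition evaluates, and what remains is, without noise and regularisation,
  \<open>6 \<parallel>f E\<parallel>\<^sup>2 \<le> \<parallel>f W\<parallel>\<^sup>2\<close> (\<open>tangent_energy_bound\<close>). The two isometry hypotheses thus enter exactly
  where they are available: the lower one at \<open>E\<close>, the upper one at \<open>W\<close>.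

  It remains to bound \<open>\<parallel>W\<parallel>\<close> by \<open>\<parallel>E\<parallel>\<close>. The factors of \<open>M\<^sub>0\<close> are determined up to a common
  orthogonal matrix, which is chosen such that \<open>U\<^sup>T D\<^sub>1 + V\<^sup>T D\<^sub>2\<close> is symmetric and positive
  semidefinite (\<open>polar_decomposition\<close>). For stacked factors \<open>X = [U; V]\<close>, \<open>D = [D\<^sub>1; D\<^sub>2]\<close> this
  alignment gives \<open>\<parallel>X D\<^sup>T + D X\<^sup>T - 2 D D\<^sup>T\<parallel>\<^sup>2 \<le> (2 + sqrt 5) \<parallel>X X\<^sup>T - D D\<^sup>T\<parallel>\<^sup>2\<close>
  (\<open>aligned_linearisation_bound\<close>), and for balanced factors, \<open>U\<^sup>T U = V\<^sup>T V\<close>, the estimate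
  passes to the off-diagonal blocks, that is, to \<open>\<parallel>W\<parallel>\<^sup>2 \<le> (2 + sqrt 5) \<parallel>E\<parallel>\<^sup>2\<close>
  (\<open>balanced_linearisation_bound\<close>).

  The noise appears in three terms. \<open>\<langle>\<Xi>, W\<rangle>\<close> and a trace are controlled by rank and operator
  norm (\<open>inner_le_opnorm_rank\<close>). The third, \<open>\<langle>\<Xi>, E\<rangle>\<close> together with the regulariser, is half the
  inner product of \<open>X X\<^sup>T - D D\<^sup>T\<close> with \<open>[0, \<Xi>; \<Xi>\<^sup>T, 0] - \<lambda> I\<close>; positivity of \<open>X X\<^sup>T\<close> is what
  lets \<open>\<lambda>\<close> cancel the noise on the large rank \<open>r\<close> (\<open>regularised_noise_bound\<close>).

  For \<open>\<lambda> > 0\<close> criticality forces \<open>U\<^sup>T U = V\<^sup>T V\<close>. For \<open>\<lambda> = 0\<close> the pair is replaced by a balanced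
  one with the same product: if \<open>U\<close> and \<open>V\<close> are injective this is a change of basis, and
  otherwise the gradient with respect to \<open>M\<close> vanishes (\<open>ex_balanced_factor_critical\<close>). The
  symmetric problem is the case \<open>V = U\<close>, \<open>D\<^sub>2 = D\<^sub>1\<close> of the same estimates.
\<close>

section \<open>Trace inner product and matrix products\<close>

lemma transpose_add: "transpose (A + B) = transpose A + transpose (B :: real^'n^'m)"
  by (simp add: transpose_def vec_eq_iff)

lemma transpose_diff: "transpose (A - B) = transpose A - transpose (B :: real^'n^'m)"
  by (simp add: transpose_def vec_eq_iff)

lemma matrix_add_rdistrib: "(A + B) ** C = A ** C + B ** (C :: real^'k^'n)"
  by (simp add: matrix_matrix_mult_def vec_eq_iff ring_distribs sum.distrib)

lemma matrix_diff_rdistrib: "(A - B) ** C = A ** C - B ** (C :: real^'k^'n)"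
  by (simp add: matrix_matrix_mult_def vec_eq_iff ring_distribs sum_subtractf)

lemma matrix_diff_ldistrib: "A ** (B - C) = A ** B - A ** (C :: real^'k^'n)"
  by (simp add: matrix_matrix_mult_def vec_eq_iff ring_distribs sum_subtractf)

lemma matrix_scaleR_left: "(c *\<^sub>R A) ** B = c *\<^sub>R (A ** (B :: real^'k^'n))"
  by (simp add: matrix_matrix_mult_def vec_eq_iff sum_distrib_left mult_ac)

lemma matrix_scaleR_right: "A ** (c *\<^sub>R B) = c *\<^sub>R (A ** (B :: real^'k^'n))"
  by (simp add: matrix_matrix_mult_def vec_eq_iff sum_distrib_left mult_ac)

lemmas matrix_distribs = transpose_add transpose_diff matrix_add_ldistrib matrix_add_rdistrib
  matrix_diff_rdistrib matrix_diff_ldistrib matrix_scaleR_left matrix_scaleR_right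
  transpose_scalar matrix_transpose_mul

lemma inner_matrix_entries: "A \<bullet> B = (\<Sum>i\<in>UNIV. \<Sum>j\<in>UNIV. A$i$j * B$i$j)" for A B :: "real^'n^'m"
  by (simp add: inner_vec_def)

lemma inner_transpose: "transpose A \<bullet> transpose B = A \<bullet> (B :: real^'n^'m)"
  unfolding inner_matrix_entries transpose_def by (simp, rule sum.swap)

lemma inner_transpose_left: "transpose A \<bullet> B = A \<bullet> transpose (B :: real^'n^'m)"
  by (metis inner_transpose transpose_transpose)

lemma norm_transpose: "norm (transpose A) = norm (A :: real^'n^'m)"
  by (simp add: norm_eq_sqrt_inner inner_transpose)

lemma inner_mult_left:
  fixes A :: "real^'n^'m" and B :: "real^'k^'n"
  shows "(A ** B) \<bullet> C = B \<bullet> (transpose A ** C)"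
proof -
  have "(A ** B) \<bullet> C = (\<Sum>i\<in>UNIV. \<Sum>j\<in>UNIV. \<Sum>k\<in>UNIV. A$i$k * B$k$j * C$i$j)"
    by (simp add: inner_matrix_entries matrix_matrix_mult_def sum_distrib_right)
  also have "\<dots> = (\<Sum>k\<in>UNIV. \<Sum>j\<in>UNIV. \<Sum>i\<in>UNIV. A$i$k * B$k$j * C$i$j)"
    by (subst sum.swap, subst sum.swap, subst (2) sum.swap) simp
  also have "\<dots> = B \<bullet> (transpose A ** C)"
    by (simp add: inner_matrix_entries matrix_matrix_mult_def transpose_def sum_distrib_left mult_ac)
  finally show ?thesis .
qed

lemma inner_mult_right:
  fixes A :: "real^'n^'m" and B :: "real^'k^'n"
  shows "(A ** B) \<bullet> C = A \<bullet> (C ** transpose B)"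
proof -
  have "(A ** B) \<bullet> C = (transpose B ** transpose A) \<bullet> transpose C"
    by (simp flip: matrix_transpose_mul add: inner_transpose)
  also have "\<dots> = transpose A \<bullet> (B ** transpose C)"
    by (simp add: inner_mult_left)
  also have "\<dots> = A \<bullet> (C ** transpose B)"
    by (simp add: inner_transpose_left matrix_transpose_mul)
  finally show ?thesis .
qed

text \<open>
  Gram matrices carry all inner products of outer products of factors; through this identity the
  estimates below take place between \<open>r\<close> by \<open>r\<close> matrices only.
\<close>
lemma inner_gram:
  fixes A :: "real^'r^'m" and B :: "real^'r^'n"
  shows "(A ** transpose B) \<bullet> (C ** transpose D) = (transpose A ** C) \<bullet> (transpose B ** D)"
proof -
  have "(A ** transpose B) \<bullet> (C ** transpose D) = (transpose A ** C ** transpose D) \<bullet> transpose B"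
    using inner_mult_left[of A "transpose B" "C ** transpose D"]
    by (metis inner_commute matrix_mul_assoc)
  also have "\<dots> = (transpose A ** C) \<bullet> (transpose B ** D)"
    using inner_mult_right[of "transpose A ** C" "transpose D" "transpose B"] by simp
  finally show ?thesis .
qed

section \<open>Linearising an aligned Gram difference\<close>

lemma inner_gram_psd_nonneg:
  fixes A :: "real^'r^'m" and N :: "real^'r^'r"
  assumes "\<And>v. 0 \<le> v \<bullet> (N *v v)"
  shows "0 \<le> (transpose A ** A) \<bullet> N"
proof -
  have "(transpose A ** A) \<bullet> N = (A ** N) \<bullet> A"
    using inner_mult_left[of A N A] by (metis inner_commute)
  also have "\<dots> = (\<Sum>i\<in>UNIV. (A$i v* N) \<bullet> A$i)"
    by (simp add: inner_vec_def matrix_matrix_mult_def vector_matrix_mult_def mult_ac)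
  also have "\<dots> = (\<Sum>i\<in>UNIV. A$i \<bullet> (N *v A$i))"
    by (metis (no_types) dot_lmul_matrix)
  finally show ?thesis
    by (simp add: assms sum_nonneg)
qed

lemma norm_add_transpose:
  fixes A :: "real^'n^'n"
  shows "(norm (A + transpose A))\<^sup>2 = 2 * (norm A)\<^sup>2 + 2 * (A \<bullet> transpose A)"
  by (simp add: power2_norm_eq_inner inner_simps inner_transpose inner_commute)

lemma norm_gram_diff:
  fixes X D :: "real^'r^'n"
  shows "(norm (X ** transpose X - D ** transpose D))\<^sup>2
    = (norm (transpose X ** X))\<^sup>2 + (norm (transpose D ** D))\<^sup>2 - 2 * (norm (transpose X ** D))\<^sup>2"
  by (simp add: power2_norm_eq_inner inner_simps inner_gram)
     (metis inner_gram inner_commute inner_transpose matrix_transpose_mul transpose_transpose)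

lemma norm_outer_squared:
  fixes X :: "real^'r^'n" and D :: "real^'r^'m"
  shows "(norm (X ** transpose D))\<^sup>2 = (transpose X ** X) \<bullet> (transpose D ** D)"
  by (simp add: power2_norm_eq_inner inner_gram)

text \<open>
  With \<open>T = D\<^sup>T \<Delta>\<close> (symmetric, because \<open>X\<^sup>T D\<close> is), \<open>G = \<Delta>\<^sup>T \<Delta>\<close> and \<open>q = \<langle>G, D\<^sup>T D\<rangle>\<close>, the
  left-hand side is \<open>2 q + 2 \<parallel>T\<parallel>\<^sup>2\<close> and the Gram difference exceeds it by \<open>4 \<langle>G, T\<rangle> + \<parallel>G\<parallel>\<^sup>2\<close>.
  The only possibly negative term, \<open>\<langle>G, T\<rangle>\<close>, is at least \<open>- q\<close> by positivity of
  \<open>X\<^sup>T D = D\<^sup>T D + T\<close> and at least \<open>- \<parallel>G\<parallel> \<parallel>T\<parallel>\<close>. The constant \<open>\<kappa> = 2 + sqrt 5\<close> is the root of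
  \<open>\<kappa>\<^sup>2 = 4 \<kappa> + 1\<close> at which the remaining quadratic form in \<open>(\<parallel>T\<parallel>, \<parallel>G\<parallel>)\<close> degenerates to a square.
\<close>
lemma aligned_linearisation_bound:
  fixes X D :: "real^'r^'n"
  assumes sym: "transpose (transpose X ** D) = transpose X ** D"
    and psd: "\<And>v. 0 \<le> v \<bullet> ((transpose X ** D) *v v)"
  defines "\<Delta> \<equiv> X - D"
  shows "(norm (\<Delta> ** transpose D + D ** transpose \<Delta>))\<^sup>2
          \<le> (2 + sqrt 5) * (norm (X ** transpose X - D ** transpose D))\<^sup>2"
    and "2 * (norm (transpose D ** \<Delta>))\<^sup>2 \<le> (norm (\<Delta> ** transpose D + D ** transpose \<Delta>))\<^sup>2"
proof -
  define T where "T = transpose D ** \<Delta>"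
  define G where "G = transpose \<Delta> ** \<Delta>"
  define W where "W = \<Delta> ** transpose D + D ** transpose \<Delta>"
  define q where "q = G \<bullet> (transpose D ** D)"
  define \<kappa> :: real where "\<kappa> = 2 + sqrt 5"
  have DX: "transpose D ** X = transpose X ** D"
    using sym by (simp add: matrix_transpose_mul)
  have T_sym: "transpose T = T"
    using DX by (simp add: T_def \<Delta>_def matrix_distribs)
  have W: "(norm W)\<^sup>2 = 2 * q + 2 * (norm T)\<^sup>2"
  proof -
    have "W = \<Delta> ** transpose D + transpose (\<Delta> ** transpose D)"
      by (simp add: W_def matrix_transpose_mul)
    moreover have "(norm (\<Delta> ** transpose D))\<^sup>2 = q"
      by (simp add: norm_outer_squared q_def G_def)
    moreover have "(\<Delta> ** transpose D) \<bullet> transpose (\<Delta> ** transpose D) = (norm T)\<^sup>2"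
      using inner_gram[of \<Delta> D D \<Delta>] T_sym
      by (simp add: matrix_transpose_mul T_def power2_norm_eq_inner)
    ultimately show ?thesis
      by (simp add: norm_add_transpose)
  qed
  have E: "X ** transpose X - D ** transpose D = W + \<Delta> ** transpose \<Delta>"
    by (simp add: W_def \<Delta>_def matrix_distribs)
  have "W \<bullet> (\<Delta> ** transpose \<Delta>) = 2 * (G \<bullet> T)"
    using T_sym inner_gram[of \<Delta> D \<Delta> \<Delta>] inner_gram[of D \<Delta> \<Delta> \<Delta>]
    by (simp add: W_def inner_add_left T_def G_def matrix_transpose_mul inner_commute[of "transpose \<Delta> ** \<Delta>"])
  then have E_norm: "(norm (X ** transpose X - D ** transpose D))\<^sup>2 = (norm W)\<^sup>2 + 4 * (G \<bullet> T) + (norm G)\<^sup>2"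
    unfolding E by (simp add: power2_norm_eq_inner inner_simps inner_gram G_def inner_commute)
  have "q + G \<bullet> T = G \<bullet> (transpose X ** D)"
    using DX by (simp add: q_def T_def \<Delta>_def matrix_distribs flip: inner_add_right)
  then have q: "- (G \<bullet> T) \<le> q"
    using inner_gram_psd_nonneg[OF psd, of \<Delta>] by (simp add: G_def)
  have q0: "0 \<le> q"
    unfolding q_def G_def norm_outer_squared[symmetric] by simp
  have cs: "- (G \<bullet> T) \<le> norm T * norm G"
    using Cauchy_Schwarz_ineq2[of G T] by (simp add: mult.commute abs_le_iff)
  have k1: "\<kappa>\<^sup>2 = 4 * \<kappa> + 1" and k4: "4 \<le> \<kappa>"
  proof -
    show "\<kappa>\<^sup>2 = 4 * \<kappa> + 1" by (simp add: \<kappa>_def power2_sum)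
    have "2 \<le> sqrt 5" by (rule real_le_rsqrt) simp
    then show "4 \<le> \<kappa>" by (simp add: \<kappa>_def)
  qed
  \<comment> \<open>The coefficient \<open>1 + 4 \<kappa> - \<kappa>\<^sup>2\<close> below vanishes by the choice of \<open>\<kappa>\<close>.\<close>
  have "0 \<le> ((\<kappa> + 1) * norm T - \<kappa> * norm G)\<^sup>2"
    by simp
  also have "\<dots> = \<kappa> * (2 * (\<kappa> - 1) * (norm T)\<^sup>2 - 2 * (\<kappa> + 1) * (norm T * norm G) + \<kappa> * (norm G)\<^sup>2)
      + (1 + 4 * \<kappa> - \<kappa>\<^sup>2) * (norm T)\<^sup>2"
    by (simp add: power2_eq_square algebra_simps)
  finally have square: "0 \<le> 2 * (\<kappa> - 1) * (norm T)\<^sup>2 - 2 * (\<kappa> + 1) * (norm T * norm G) + \<kappa> * (norm G)\<^sup>2"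
    using k1 k4 by (simp add: zero_le_mult_iff)
  have "2 * (\<kappa> + 1) * - (G \<bullet> T) \<le> 2 * (\<kappa> + 1) * (norm T * norm G)"
    by (rule mult_left_mono[OF cs]) (use k4 in simp)
  moreover have "0 \<le> 2 * (\<kappa> - 1) * (q + G \<bullet> T)"
    using q k4 by simp
  ultimately have "0 \<le> (\<kappa> - 1) * (norm W)\<^sup>2 + 4 * \<kappa> * (G \<bullet> T) + \<kappa> * (norm G)\<^sup>2"
    using square unfolding W by (simp add: algebra_simps)
  then show "(norm W)\<^sup>2 \<le> (2 + sqrt 5) * (norm (X ** transpose X - D ** transpose D))\<^sup>2"
    unfolding E_norm \<kappa>_def[symmetric] by (simp add: algebra_simps)
  show "2 * (norm T)\<^sup>2 \<le> (norm W)\<^sup>2"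
    using q0 by (simp add: W)
qed

section \<open>Inner products, rank and operator norm\<close>

lemma rank_add_le:
  fixes A B :: "real^'n^'m"
  shows "rank (A + B) \<le> rank A + rank B"
proof -
  let ?S = "range ((*v) A)" and ?T = "range ((*v) B)"
  have "rank (A + B) \<le> dim {x + y |x y. x \<in> ?S \<and> y \<in> ?T}"
    unfolding rank_dim_range by (intro dim_subset) (auto simp: matrix_vector_mult_add_rdistrib)
  also have "\<dots> \<le> dim ?S + dim ?T"
    using dim_sums_Int[of ?S ?T] by (simp add: linear_subspace_image)
  finally show ?thesis
    by (simp add: rank_dim_range)
qed

lemma rank_diff_le:
  fixes A B :: "real^'n^'m"
  shows "rank (A - B) \<le> rank A + rank B"
proof -
  have "rank (A - B) = rank (A + ((-1) *\<^sub>R mat 1) ** B)"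
    using matrix_scaleR_left[of "-1" "mat 1 :: real^'m^'m" B] by simp
  also have "\<dots> \<le> rank A + rank (((-1) *\<^sub>R mat 1 :: real^'m^'m) ** B)"
    by (rule rank_add_le)
  also have "\<dots> \<le> rank A + rank B"
    by (intro add_left_mono rank_mul_le_right)
  finally show ?thesis .
qed

lemma norm_matrix_columns:
  fixes A :: "real^'n^'m"
  shows "(norm A)\<^sup>2 = (\<Sum>j\<in>UNIV. (norm (column j A))\<^sup>2)"
  unfolding power2_norm_eq_inner inner_matrix_entries inner_vec_def column_def
  by (simp, rule sum.swap)

lemma column_mult: "column j (A ** B) = A *v column j (B :: real^'k^'n)"
  by (simp add: vec_eq_iff column_def matrix_matrix_mult_def matrix_vector_mult_def)

lemma norm_mult_le:
  fixes C :: "real^'n^'m" and B :: "real^'k^'n"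
  assumes "\<And>x. norm (C *v x) \<le> c * norm x" and "0 \<le> c"
  shows "norm (C ** B) \<le> c * norm B"
proof (rule power2_le_imp_le)
  have "(norm (C ** B))\<^sup>2 \<le> (\<Sum>j\<in>UNIV. (c * norm (column j B))\<^sup>2)"
    unfolding norm_matrix_columns[of "C ** B"] column_mult
    by (intro sum_mono power_mono assms) simp
  also have "\<dots> = (c * norm B)\<^sup>2"
    by (simp add: power_mult_distrib norm_matrix_columns[of B] sum_distrib_left)
  finally show "(norm (C ** B))\<^sup>2 \<le> (c * norm B)\<^sup>2" .
qed (use assms in simp)

lemma norm_transpose_mult_vector_le:
  fixes C :: "real^'n^'m"
  assumes "\<And>x. norm (C *v x) \<le> c * norm x"
  shows "norm (transpose C *v y) \<le> c * norm y"
proof (cases "transpose C *v y = 0")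
  case False
  let ?z = "transpose C *v y"
  have "norm ?z * norm ?z = y \<bullet> (C *v ?z)"
    by (metis dot_lmul_matrix transpose_matrix_vector norm_eq_sqrt_inner real_sqrt_mult_self abs_of_nonneg inner_ge_zero)
  also have "\<dots> \<le> norm y * norm (C *v ?z)"
    by (rule norm_cauchy_schwarz)
  also have "\<dots> \<le> norm y * (c * norm ?z)"
    by (intro mult_left_mono assms) simp
  finally have "norm ?z * norm ?z \<le> (c * norm y) * norm ?z"
    by (simp add: mult_ac)
  then show ?thesis
    using False by (simp add: mult_le_cancel_right)
next
  case True
  have "0 \<le> c"  if "y \<noteq> 0"
    using order_trans[OF norm_ge_zero assms[of "axis (SOME i. True) 1"]] by simp
  then show ?thesis
    using True by (cases "y = 0") auto
qed

text \<open>
  The nonzero columns of \<open>F\<close> are an orthonormal basis of the range of \<open>D\<close>. The number of columns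
  of \<open>F\<close> is free as long as the basis fits, which also makes \<open>F\<close> the left factor of a
  factorisation of \<open>D\<close> with a prescribed inner dimension.
\<close>
lemma orthonormal_frame_of_range:
  fixes D :: "real^'k^'n"
  assumes "rank D \<le> CARD('r)"
  obtains F :: "real^'r^'n" and Z
  where "F ** transpose F ** D = D" "F = D ** Z" "(norm F)\<^sup>2 = real (rank D)"
proof -
  let ?S = "range ((*v) D)"
  have "subspace ?S"
    by (simp add: linear_subspace_image)
  then obtain B where B: "pairwise orthogonal B" "\<And>x. x \<in> B \<Longrightarrow> norm x = 1" "independent B"
      "card B = dim ?S" "span B = ?S"
    by (metis orthonormal_basis_subspace)
  then have fin: "finite B"
    using independent_imp_finite by blast
  have "card B \<le> CARD('r)"
    using B(4) assms by (simp add: rank_dim_range)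
  then obtain f :: "real^'n \<Rightarrow> 'r" where f: "inj_on f B"
    using card_le_inj[OF fin, of "UNIV :: 'r set"] by auto
  \<comment> \<open>There may be more columns than basis vectors; the remaining ones are zero.\<close>
  define col where "col s = (if s \<in> f ` B then inv_into B f s else 0)" for s
  define F :: "real^'r^'n" where "F = (\<chi> i s. col s $ i)"
  have col_sum: "(\<Sum>s\<in>UNIV. g (col s)) = (\<Sum>b\<in>B. g b)" if "g 0 = 0" for g :: "real^'n \<Rightarrow> 'c::comm_monoid_add"
  proof -
    have "(\<Sum>s\<in>UNIV. g (col s)) = (\<Sum>s\<in>f ` B. g (col s))"
      using that by (intro sum.mono_neutral_right) (auto simp: col_def)
    also have "\<dots> = (\<Sum>b\<in>B. g (col (f b)))"
      using f by (simp add: sum.reindex)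
    also have "\<dots> = (\<Sum>b\<in>B. g b)"
      using f by (intro sum.cong) (auto simp: col_def)
    finally show ?thesis .
  qed
  have column_F: "column s F = col s" for s
    by (simp add: F_def column_def)
  have F_vec: "F *v y = (\<Sum>s\<in>UNIV. y$s *\<^sub>R col s)" for y
    by (simp add: F_def vec_eq_iff matrix_vector_mult_def mult.commute)
  have FF: "(F ** transpose F) *v x = (\<Sum>b\<in>B. (x \<bullet> b) *\<^sub>R b)" for x
  proof -
    have "(transpose F *v x)$s = x \<bullet> col s" for s
      by (simp add: F_def transpose_def matrix_vector_mult_def inner_vec_def mult.commute del: transpose_matrix_vector)
    then have "(F ** transpose F) *v x = (\<Sum>s\<in>UNIV. (x \<bullet> col s) *\<^sub>R col s)"
      by (simp add: F_vec del: transpose_matrix_vector flip: matrix_vector_mul_assoc)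
    then show ?thesis
      using col_sum[of "\<lambda>b. (x \<bullet> b) *\<^sub>R b"] by simp
  qed
  have FF_id: "(F ** transpose F) *v x = x" if "x \<in> ?S" for x
    unfolding FF using orthonormal_basis_expand[OF B(1,2)] that fin B(5) by blast
  have "col s \<in> span B" for s
    by (auto simp: col_def span_zero intro!: span_base inv_into_into)
  then have "\<forall>s. \<exists>z. col s = D *v z"
    unfolding B(5) by blast
  then obtain z where z: "\<And>s. col s = D *v z s"
    by metis
  have "column s (D ** (\<chi> i s. z s $ i)) = column s F" for s
    unfolding column_mult column_F z by (simp add: column_def)
  then have "F = D ** (\<chi> i s. z s $ i)"
    by (simp add: column_def vec_eq_iff)
  moreover have "F ** transpose F ** D = D"
    by (simp add: matrix_eq FF_id flip: matrix_vector_mul_assoc[of "F ** transpose F"])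
  moreover have "(norm F)\<^sup>2 = real (rank D)"
  proof -
    have "(norm F)\<^sup>2 = (\<Sum>b\<in>B. (norm b)\<^sup>2)"
      unfolding norm_matrix_columns column_F using col_sum[of "\<lambda>b. (norm b)\<^sup>2"] by simp
    then show ?thesis
      using B(2,4) by (simp add: rank_dim_range)
  qed
  ultimately show thesis
    using that by blast
qed

lemma range_projector:
  fixes D :: "real^'r^'n"
  obtains P :: "real^'n^'n" and Z
  where "transpose P = P" "P ** P = P" "P ** D = D" "(norm P)\<^sup>2 = real (rank D)" "P = D ** Z"
proof -
  have "rank D \<le> CARD('n)"
    using rank_bound[of D] by simp
  then obtain F :: "real^'n^'n" and Z
    where F: "F ** transpose F ** D = D" "F = D ** Z" "(norm F)\<^sup>2 = real (rank D)"
    by (rule orthonormal_frame_of_range)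
  let ?P = "F ** transpose F"
  have PF: "?P ** F = F"
    using F(1,2) by (metis matrix_mul_assoc)
  have "(norm ?P)\<^sup>2 = F \<bullet> (?P ** F)"
    using inner_mult_right[of F "transpose F" ?P] by (simp add: power2_norm_eq_inner)
  then have "(norm ?P)\<^sup>2 = real (rank D)"
    by (simp add: PF F(3) flip: power2_norm_eq_inner)
  moreover have "?P = D ** (Z ** transpose F)"
    using F(2) by (metis matrix_mul_assoc)
  moreover have "?P ** ?P = ?P"
    using PF by (simp add: matrix_mul_assoc)
  moreover have "transpose ?P = ?P"
    by (simp add: matrix_transpose_mul)
  ultimately show thesis
    using that[of ?P] F(1) by blast
qed

text \<open>
  Duality of operator and nuclear norm, combined with \<open>\<parallel>Y\<parallel>\<^sub>* \<le> sqrt (rank Y) \<parallel>Y\<parallel>\<close>. With \<open>P\<close> the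
  projector onto the range of \<open>Y\<close>, \<open>\<langle>C, Y\<rangle> = \<langle>P C, Y\<rangle>\<close>, and \<open>\<parallel>P C\<parallel> \<le> c \<parallel>P\<parallel> = c sqrt (rank Y)\<close>.
\<close>
lemma inner_le_opnorm_rank:
  fixes C Y :: "real^'n^'m"
  assumes "\<And>x. norm (C *v x) \<le> c * norm x" and c: "0 \<le> c"
  shows "\<bar>C \<bullet> Y\<bar> \<le> c * sqrt (real (rank Y)) * norm Y"
proof -
  obtain P :: "real^'m^'m" where P: "transpose P = P" "P ** Y = Y" "(norm P)\<^sup>2 = real (rank Y)"
    using range_projector[of Y] by metis
  have "C \<bullet> Y = (P ** C) \<bullet> Y"
    using inner_mult_left[of P C Y] P by simp
  then have "\<bar>C \<bullet> Y\<bar> \<le> norm (P ** C) * norm Y"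
    by (metis Cauchy_Schwarz_ineq2)
  also have "norm (P ** C) = norm (transpose C ** P)"
    by (metis norm_transpose matrix_transpose_mul P(1))
  also have "\<dots> \<le> c * norm P"
    by (rule norm_mult_le[OF norm_transpose_mult_vector_le[OF assms(1)] c])
  also have "norm P = sqrt (real (rank Y))"
    by (metis P(3) norm_ge_zero real_sqrt_unique)
  finally show ?thesis
    by (simp add: mult_right_mono)
qed

section \<open>Noise against the regulariser\<close>

text \<open>
  In terms of eigenvalues, the left-hand side is at most twice the trace of the negative part of
  \<open>E\<close>, whose rank is at most \<open>rank D\<close>. The estimate follows by splitting \<open>E\<close> along the range of
  \<open>D\<close> (projector \<open>P\<close>) and its complement (\<open>Q\<close>). On the complement \<open>E\<close> is \<open>(Q X) (Q X)\<^sup>T\<close>, and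
  \<open>C - I\<close> is negative semidefinite. The other blocks \<open>F = P E P\<close> and \<open>G = P E Q\<close> cost
  \<open>sqrt (rank D)\<close> times \<open>\<parallel>F\<parallel> + \<parallel>F + 2 G\<parallel>\<close>, where \<open>\<parallel>F\<parallel>\<^sup>2 + 2 \<parallel>G\<parallel>\<^sup>2 \<le> \<parallel>E\<parallel>\<^sup>2\<close>; the sum is at most
  \<open>2 \<parallel>E\<parallel>\<close>.
\<close>
lemma contraction_minus_id_inner_le:
  fixes X D :: "real^'r^'n" and C :: "real^'n^'n"
  assumes C_sym: "transpose C = C" and C: "\<And>x. norm (C *v x) \<le> norm x"
  defines "E \<equiv> X ** transpose X - D ** transpose D"
  shows "(C - mat 1) \<bullet> E \<le> 2 * sqrt (real (rank D)) * norm E"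
proof -
  obtain P :: "real^'n^'n" where P: "transpose P = P" "P ** P = P" "P ** D = D" "(norm P)\<^sup>2 = real (rank D)"
    using range_projector[of D] by metis
  define k where "k = sqrt (real (rank D))"
  have normP: "norm P = k"
    by (metis P(4) k_def norm_ge_zero real_sqrt_unique)
  define Q where "Q = mat 1 - P"
  have Q: "transpose Q = Q" "Q ** Q = Q" "P ** Q = 0" "Q ** P = 0" "Q ** D = 0"
    by (simp_all add: Q_def matrix_distribs P)
  have E_sym: "transpose E = E"
    by (simp add: E_def matrix_distribs)
  define F where "F = P ** E ** P"
  define G where "G = P ** E ** Q"
  have E_split: "E = F + G + transpose G + Q ** E ** Q"
  proof -
    have "E = (P + Q) ** E ** (P + Q)"
      by (simp add: Q_def)
    also have "\<dots> = F + G + transpose G + Q ** E ** Q"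
      unfolding F_def G_def
      by (simp add: matrix_add_ldistrib matrix_add_rdistrib matrix_transpose_mul P Q E_sym matrix_mul_assoc)
    finally show ?thesis .
  qed
  have neg: "(C - mat 1) \<bullet> (Q ** E ** Q) \<le> 0"
  proof -
    have "Q ** E ** Q = (Q ** X) ** transpose (Q ** X)"
    proof -
      have "Q ** E = Q ** X ** transpose X"
        by (simp add: E_def matrix_diff_ldistrib matrix_mul_assoc Q)
      then show ?thesis
        by (simp add: matrix_transpose_mul Q matrix_mul_assoc)
    qed
    moreover have "0 \<le> (Q ** X ** transpose (Q ** X)) \<bullet> (mat 1 - C)"
    proof -
      have "x \<bullet> (C *v x) \<le> x \<bullet> x" for x
      proof -
        have "x \<bullet> (C *v x) \<le> norm x * norm (C *v x)"
          by (rule norm_cauchy_schwarz)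
        also have "\<dots> \<le> norm x * norm x"
          by (intro mult_left_mono C) simp
        finally show ?thesis
          by (simp add: power2_eq_square flip: power2_norm_eq_inner)
      qed
      then show ?thesis
        using inner_gram_psd_nonneg[of "mat 1 - C" "transpose (Q ** X)"]
        by (simp add: matrix_vector_mult_diff_rdistrib inner_diff_right)
    qed
    ultimately show ?thesis
      by (simp add: inner_diff_left inner_diff_right inner_commute)
  qed
  have trF: "- (mat 1 \<bullet> F) \<le> k * norm F"
  proof -
    have "mat 1 \<bullet> F = P \<bullet> F"
      using inner_mult_left[of P "mat 1" F] P by (simp add: F_def matrix_mul_assoc)
    then show ?thesis
      using Cauchy_Schwarz_ineq2[of P F] by (simp add: normP abs_le_iff)
  qed
  have trG: "mat 1 \<bullet> G = 0"
  proof -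
    have "G = P ** G" "G = G ** Q"
      by (simp_all add: G_def matrix_mul_assoc P) (simp flip: matrix_mul_assoc add: Q)
    then have "G \<bullet> mat 1 = (P ** Q) \<bullet> G"
      using inner_mult_left[of P G "mat 1"] inner_mult_right[of G Q P] P Q by (simp add: inner_commute)
    then show ?thesis
      by (simp add: Q inner_commute)
  qed
  have CFG: "C \<bullet> (F + 2 *\<^sub>R G) \<le> k * norm (F + 2 *\<^sub>R G)"
  proof -
    have "F + 2 *\<^sub>R G = P ** (F + 2 *\<^sub>R G)"
      by (simp add: F_def G_def matrix_add_ldistrib matrix_scaleR_right matrix_mul_assoc P)
    then have "C \<bullet> (F + 2 *\<^sub>R G) = (P ** C) \<bullet> (F + 2 *\<^sub>R G)"
      using inner_mult_left[of P C "F + 2 *\<^sub>R G"] P by simp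
    also have "\<dots> \<le> norm (P ** C) * norm (F + 2 *\<^sub>R G)"
      by (rule norm_cauchy_schwarz)
    also have "\<dots> \<le> k * norm (F + 2 *\<^sub>R G)"
    proof (rule mult_right_mono)
      have "norm (P ** C) = norm (C ** P)"
        by (metis norm_transpose matrix_transpose_mul P(1) C_sym)
      also have "\<dots> \<le> 1 * norm P"
        by (rule norm_mult_le) (use C in auto)
      finally show "norm (P ** C) \<le> k"
        by (simp add: normP)
    qed simp
    finally show ?thesis .
  qed
  have FG: "F \<bullet> G = 0" "F \<bullet> transpose G = 0" "G \<bullet> transpose G = 0" "F \<bullet> (Q ** E ** Q) = 0"
    "G \<bullet> (Q ** E ** Q) = 0" "transpose G \<bullet> (Q ** E ** Q) = 0"
  proof -
    have left: "(P ** Y) \<bullet> Z = 0" if "P ** Z = 0" for Y Z :: "real^'n^'n"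
      using inner_mult_left[of P Y Z] that P by simp
    have right: "(Y ** P) \<bullet> Z = 0" if "Z ** P = 0" for Y Z :: "real^'n^'n"
      using inner_mult_right[of Y P Z] that P by simp
    have G_tr: "transpose G = Q ** E ** P"
      by (simp add: G_def matrix_transpose_mul P Q E_sym matrix_mul_assoc)
    have kill: "G ** P = 0" "P ** transpose G = 0" "P ** (Q ** E ** Q) = 0" "(Q ** E ** Q) ** P = 0"
      unfolding G_tr by (simp_all add: G_def matrix_mul_assoc Q)
        (simp_all flip: matrix_mul_assoc add: Q)
    show "F \<bullet> G = 0"
      unfolding F_def by (rule right[OF kill(1)])
    show "F \<bullet> transpose G = 0" "F \<bullet> (Q ** E ** Q) = 0"
      using left[OF kill(2), of "E ** P"] left[OF kill(3), of "E ** P"] by (simp_all add: F_def matrix_mul_assoc)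
    show "G \<bullet> transpose G = 0" "G \<bullet> (Q ** E ** Q) = 0"
      using left[OF kill(2), of "E ** Q"] left[OF kill(3), of "E ** Q"] by (simp_all add: G_def matrix_mul_assoc)
    show "transpose G \<bullet> (Q ** E ** Q) = 0"
      unfolding G_tr by (rule right[OF kill(4)])
  qed
  have normE: "(norm F)\<^sup>2 + 2 * (norm G)\<^sup>2 \<le> (norm E)\<^sup>2"
  proof -
    have "(norm E)\<^sup>2 = (norm F)\<^sup>2 + 2 * (norm G)\<^sup>2 + (norm (Q ** E ** Q))\<^sup>2"
      using FG norm_transpose[of G]
      unfolding power2_norm_eq_inner by (subst E_split, subst E_split) (simp add: inner_simps inner_commute inner_transpose)
    then show ?thesis by simp
  qed
  have "norm (F + 2 *\<^sub>R G) + norm F \<le> 2 * norm E"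
  proof (rule power2_le_imp_le)
    have "(norm (F + 2 *\<^sub>R G))\<^sup>2 = (norm F)\<^sup>2 + 4 * (norm G)\<^sup>2"
      using FG(1) by (simp add: power2_norm_eq_inner inner_simps inner_commute)
    moreover have "(norm (F + 2 *\<^sub>R G) + norm F)\<^sup>2 \<le> 2 * (norm (F + 2 *\<^sub>R G))\<^sup>2 + 2 * (norm F)\<^sup>2"
      using sum_squares_bound[of "norm (F + 2 *\<^sub>R G)" "norm F"] by (simp add: power2_sum)
    ultimately show "(norm (F + 2 *\<^sub>R G) + norm F)\<^sup>2 \<le> (2 * norm E)\<^sup>2"
      using normE by (simp add: power_mult_distrib)
  qed simp
  then have bound: "k * (norm (F + 2 *\<^sub>R G) + norm F) \<le> k * (2 * norm E)"
    by (rule mult_left_mono) (simp add: k_def)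
  have "C \<bullet> transpose G = C \<bullet> G"
    by (metis C_sym inner_transpose)
  moreover have "mat 1 \<bullet> transpose G = mat 1 \<bullet> G"
    by (metis transpose_mat inner_transpose)
  ultimately have "(C - mat 1) \<bullet> E
      = C \<bullet> (F + 2 *\<^sub>R G) - mat 1 \<bullet> F + (C - mat 1) \<bullet> (Q ** E ** Q)"
    using trG by (subst E_split) (simp add: inner_simps)
  with neg CFG trF bound show ?thesis
    by (simp add: k_def algebra_simps)
qed

text \<open>
  With \<open>m = max c lam\<close>, write \<open>B - lam I = (1 - lam / m) B + lam (B / m - I)\<close>. The first summand
  has operator norm at most \<open>max (c - lam) 0\<close> and sees the full rank of \<open>E\<close>; in the second,
  \<open>B / m\<close> is a contraction, so only the rank of \<open>D\<close> matters.
\<close>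
lemma regularised_noise_bound:
  fixes X D :: "real^'r^'n" and B :: "real^'n^'n"
  assumes B_sym: "transpose B = B" and B: "\<And>x. norm (B *v x) \<le> c * norm x"
    and c: "0 \<le> c" and lam: "0 \<le> lam" and k: "rank D \<le> k"
  defines "E \<equiv> X ** transpose X - D ** transpose D"
  shows "(B - lam *\<^sub>R mat 1) \<bullet> E
    \<le> (max (c - lam) 0 * sqrt (real (CARD('r) + k)) + 2 * lam * sqrt (real k)) * norm E"
proof -
  define m where "m = max c lam"
  define C where "C = (1 / m) *\<^sub>R B"
  have "rank E \<le> rank (X ** transpose X) + rank (D ** transpose D)"
    unfolding E_def by (rule rank_diff_le)
  also have "\<dots> \<le> CARD('r) + k"
    using rank_mul_le_left[of X "transpose X"] rank_bound[of X] rank_mul_le_left[of D "transpose D"] k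
    by linarith
  finally have rank_E: "sqrt (real (rank E)) \<le> sqrt (real (CARD('r) + k))"
    by simp
  have split: "(B - lam *\<^sub>R mat 1) \<bullet> E = (1 - lam / m) * (B \<bullet> E) + lam * ((C - mat 1) \<bullet> E)"
    if "m \<noteq> 0"
    using that by (simp add: C_def inner_simps algebra_simps)
  have C_contr: "norm (C *v x) \<le> norm x" for x
  proof (cases "m = 0")
    case False
    then have "0 < m" using c by (simp add: m_def)
    moreover have "norm (B *v x) \<le> m * norm x"
      using B[of x] by (rule order_trans) (simp add: m_def mult_right_mono)
    ultimately show ?thesis
      by (simp add: C_def field_simps flip: scaleR_matrix_vector_assoc)
  qed (simp add: C_def)
  have CE: "(C - mat 1) \<bullet> E \<le> 2 * sqrt (real k) * norm E"
  proof -
    have "transpose C = C"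
      by (simp add: C_def transpose_scalar B_sym)
    from contraction_minus_id_inner_le[OF this C_contr, of X D]
    have "(C - mat 1) \<bullet> E \<le> 2 * sqrt (real (rank D)) * norm E"
      by (simp add: E_def)
    also have "\<dots> \<le> 2 * sqrt (real k) * norm E"
      using k by (intro mult_right_mono) simp_all
    finally show ?thesis .
  qed
  have BE: "B \<bullet> E \<le> c * sqrt (real (CARD('r) + k)) * norm E"
  proof -
    have "B \<bullet> E \<le> c * sqrt (real (rank E)) * norm E"
      using inner_le_opnorm_rank[OF B c, of E] by simp
    also have "\<dots> \<le> c * sqrt (real (CARD('r) + k)) * norm E"
      by (intro mult_right_mono mult_left_mono rank_E c) simp
    finally show ?thesis .
  qed
  show ?thesis
  proof (cases "m = 0")
    case True
    then have "lam = 0" "c = 0" using c lam by (simp_all add: m_def max_def split: if_splits)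
    then show ?thesis using BE by simp
  next
    case False
    then have m: "0 < m" using c by (simp add: m_def)
    have "(1 - lam / m) * (B \<bullet> E) \<le> (1 - lam / m) * (c * sqrt (real (CARD('r) + k)) * norm E)"
      using m by (intro mult_left_mono BE) (simp add: m_def field_simps)
    also have "\<dots> = ((1 - lam / m) * c) * (sqrt (real (CARD('r) + k)) * norm E)"
      by simp
    also have "(1 - lam / m) * c = max (c - lam) 0"
      using m by (auto simp: m_def max_def field_simps split: if_splits)
    finally have "(1 - lam / m) * (B \<bullet> E) \<le> max (c - lam) 0 * (sqrt (real (CARD('r) + k)) * norm E)" .
    moreover have "lam * ((C - mat 1) \<bullet> E) \<le> lam * (2 * sqrt (real k) * norm E)"
      by (intro mult_left_mono CE lam)
    ultimately show ?thesis
      unfolding split[OF False] by (simp add: algebra_simps)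
  qed
qed

section \<open>Balanced, positive semidefinite and aligned factorisations\<close>

definition outer_prod :: "real^'m \<Rightarrow> real^'n \<Rightarrow> real^'n^'m" where
  "outer_prod v w = (\<chi> i j. v$i * w$j)"

lemma outer_prod_mult_vector: "outer_prod v w *v x = (w \<bullet> x) *\<^sub>R v"
  by (simp add: outer_prod_def matrix_vector_mult_def vec_eq_iff inner_vec_def sum_distrib_left mult_ac)

lemma transpose_outer_prod: "transpose (outer_prod v w) = outer_prod w v"
  by (simp add: outer_prod_def transpose_def vec_eq_iff mult_ac)

lemma mult_outer_prod: "A ** outer_prod v w = outer_prod (A *v v) (w :: real^'k)"
  by (simp add: outer_prod_def matrix_matrix_mult_def matrix_vector_mult_def vec_eq_iff
      sum_distrib_left sum_distrib_right mult_ac)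

lemma inner_outer_prod: "A \<bullet> outer_prod v w = v \<bullet> (A *v w)"
  by (simp add: inner_matrix_entries outer_prod_def inner_vec_def matrix_vector_mult_def
      sum_distrib_left mult_ac)

lemma norm_outer_prod: "(norm (outer_prod v w))\<^sup>2 = (norm v)\<^sup>2 * (norm w)\<^sup>2"
  unfolding power2_norm_eq_inner by (simp add: inner_outer_prod outer_prod_mult_vector)

lemma symmetric_form_zero:
  fixes K :: "real^'n^'n"
  assumes sym: "transpose K = K" and form: "\<And>v. v \<bullet> (K *v v) = 0"
  shows "K = 0"
proof -
  have "K *v w = 0" for w
  proof -
    let ?z = "K *v w"
    have "?z \<bullet> (K *v w) = w \<bullet> (K *v ?z)"
      by (metis dot_lmul_matrix inner_commute sym transpose_matrix_vector)
    moreover have "(?z + w) \<bullet> (K *v (?z + w)) = 0" "?z \<bullet> (K *v ?z) = 0" "w \<bullet> (K *v w) = 0"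
      using form by blast+
    ultimately have "?z \<bullet> ?z = 0"
      by (simp add: matrix_vector_right_distrib inner_add_left inner_add_right)
    then show ?thesis by simp
  qed
  then show ?thesis
    by (simp add: matrix_eq)
qed

lemma mult_id_plus_scaleR:
  fixes O1 :: "real^'n^'n"
  assumes "O1 ** O1 = t *\<^sub>R O1"
  shows "(mat 1 + a *\<^sub>R O1) ** (mat 1 + b *\<^sub>R O1) = mat 1 + (a + b + a * b * t) *\<^sub>R O1"
  by (simp add: matrix_add_ldistrib matrix_add_rdistrib matrix_scaleR_left matrix_scaleR_right assms
      scaleR_add_left scaleR_add_right mult_ac)

lemma outer_prod_square: "outer_prod w w ** outer_prod w w = (w \<bullet> w) *\<^sub>R outer_prod w (w :: real^'n)"
  by (simp add: mult_outer_prod outer_prod_mult_vector) (simp add: outer_prod_def vec_eq_iff)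

lemma gram_quadratic_form: "v \<bullet> ((transpose A ** A) *v v) = (norm (A *v v))\<^sup>2" for A :: "real^'n^'m"
  by (metis dot_lmul_matrix inner_commute matrix_vector_mul_assoc power2_norm_eq_inner transpose_matrix_vector)

text \<open>
  Multiplication by a matrix that stretches the single direction \<open>v\<close> by the factor \<open>1 + c\<close>;
  these matrices are the variations used for the balancing below.
\<close>
lemma norm_mult_dilation:
  fixes D :: "real^'r^'n"
  assumes "norm v = 1"
  shows "(norm (D ** (mat 1 + c *\<^sub>R outer_prod v v)))\<^sup>2 = (norm D)\<^sup>2 + ((1 + c)\<^sup>2 - 1) * (norm (D *v v))\<^sup>2"
proof -
  have "D ** (mat 1 + c *\<^sub>R outer_prod v v) = D + c *\<^sub>R outer_prod (D *v v) v"
    by (simp add: matrix_add_ldistrib matrix_scaleR_right mult_outer_prod)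
  moreover have "(norm (D + c *\<^sub>R outer_prod (D *v v) v))\<^sup>2
      = (norm D)\<^sup>2 + 2 * c * (D \<bullet> outer_prod (D *v v) v) + c\<^sup>2 * (norm (outer_prod (D *v v) v))\<^sup>2"
    by (simp add: power2_norm_eq_inner inner_simps inner_commute power2_eq_square[of c])
  moreover have "D \<bullet> outer_prod (D *v v) v = (norm (D *v v))\<^sup>2"
    by (simp add: inner_outer_prod power2_norm_eq_inner)
  moreover have "(norm (outer_prod (D *v v) v))\<^sup>2 = (norm (D *v v))\<^sup>2"
    using assms by (simp add: norm_outer_prod)
  ultimately show ?thesis
    by (simp add: power2_sum algebra_simps)
qed

lemma continuous_on_matrix_mult:
  fixes f :: "'a::topological_space \<Rightarrow> real^'n^'m" and g :: "'a \<Rightarrow> real^'k^'n"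
  assumes "continuous_on S f" "continuous_on S g"
  shows "continuous_on S (\<lambda>x. f x ** g x)"
  unfolding matrix_matrix_mult_def
  by (intro continuous_on_vec_lambda continuous_intros assms)

lemma continuous_on_transpose:
  fixes f :: "'a::topological_space \<Rightarrow> real^'n^'m"
  assumes "continuous_on S f"
  shows "continuous_on S (\<lambda>x. transpose (f x))"
  unfolding transpose_def by (intro continuous_on_vec_lambda continuous_intros assms)

text \<open>
  Among all factorisations of \<open>M\<close> take one of least norm. Stretching a unit vector \<open>v\<close> by \<open>p\<close> in
  one factor and by \<open>1 / p\<close> in the other keeps the product, and minimality over all \<open>p\<close> forces
  \<open>\<parallel>D1 v\<parallel> = \<parallel>D2 v\<parallel>\<close>, which determines the Gram matrices.
\<close>
lemma ex_balanced_factorization: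
  fixes M :: "real^'m^'n"
  assumes "rank M \<le> CARD('r)"
  obtains D1 :: "real^'r^'n" and D2 :: "real^'r^'m"
  where "D1 ** transpose D2 = M" "transpose D1 ** D1 = transpose D2 ** D2"
proof -
  let ?S = "{(A :: real^'r^'n, B :: real^'r^'m). A ** transpose B = M}"
  obtain F :: "real^'r^'n" where "F ** transpose F ** M = M"
    using orthonormal_frame_of_range[OF assms] by metis
  then have "(F, transpose M ** F) \<in> ?S"
    by (simp add: matrix_transpose_mul matrix_mul_assoc)
  then have "?S \<noteq> {}" by blast
  moreover have "closed ?S"
    unfolding case_prod_beta
    by (intro closed_Collect_eq continuous_on_matrix_mult continuous_on_transpose continuous_intros)
  ultimately obtain D where D: "D \<in> ?S" "\<And>y. y \<in> ?S \<Longrightarrow> dist 0 D \<le> dist 0 y"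
    using distance_attains_inf[of ?S 0] by blast
  obtain D1 D2 where D12: "D = (D1, D2)" by (cases D)
  have prod: "D1 ** transpose D2 = M"
    using D(1) D12 by simp
  have minimal: "(norm D1)\<^sup>2 + (norm D2)\<^sup>2 \<le> (norm A)\<^sup>2 + (norm B)\<^sup>2" if "A ** transpose B = M" for A :: "real^'r^'n" and B :: "real^'r^'m"
    using D(2)[of "(A, B)"] that D12 by (simp add: norm_Pair)
  have scaled: "0 \<le> (\<tau> - 1) * (norm (D1 *v v))\<^sup>2 + (1 / \<tau> - 1) * (norm (D2 *v v))\<^sup>2"
    if v: "norm v = 1" and \<tau>: "0 < \<tau>" for v \<tau>
  proof -
    define p where "p = sqrt \<tau>"
    have p: "0 < p" "p\<^sup>2 = \<tau>" using \<tau> by (simp_all add: p_def)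
    define G where "G c = mat 1 + (c - 1) *\<^sub>R outer_prod v v" for c
    have "v \<bullet> v = 1" using v by (simp add: norm_eq_1)
    then have "G p ** G (1/p) = mat 1 + ((p - 1) + (1/p - 1) + (p - 1) * (1/p - 1) * 1) *\<^sub>R outer_prod v v"
      unfolding G_def by (intro mult_id_plus_scaleR) (simp add: outer_prod_square)
    also have "(p - 1) + (1/p - 1) + (p - 1) * (1/p - 1) * 1 = 0"
      using p by (simp add: field_simps)
    also have "G (1/p) = transpose (G (1/p))"
      by (simp add: G_def matrix_distribs transpose_outer_prod)
    finally have "(D1 ** G p) ** transpose (D2 ** G (1/p)) = M"
      using prod by (simp add: matrix_transpose_mul) (metis matrix_mul_assoc matrix_mul_rid add.right_neutral scale_zero_left)
    from minimal[OF this] show ?thesis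
      unfolding G_def norm_mult_dilation[OF v] using p by (simp add: power_divide)
  qed
  have le: "(norm (D1 *v v))\<^sup>2 = (norm (D2 *v v))\<^sup>2" if v: "norm v = 1" for v
  proof (rule antisym; rule field_le_mult_one_interval)
    fix z :: real assume z: "0 < z" "z < 1"
    let ?A = "(norm (D1 *v v))\<^sup>2" and ?B = "(norm (D2 *v v))\<^sup>2"
    have "0 \<le> z * ((z - 1) * ?A + (1 / z - 1) * ?B)"
      using scaled[OF v, of z] z by simp
    also have "\<dots> = (1 - z) * (?B - z * ?A)"
      using z by (simp add: field_simps)
    finally show "z * ?A \<le> ?B"
      using z by (simp add: zero_le_mult_iff)
    have "0 \<le> z * ((1 / z - 1) * ?A + (1 / (1 / z) - 1) * ?B)"
      using scaled[OF v, of "1 / z"] z by simp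
    also have "\<dots> = (1 - z) * (?A - z * ?B)"
      using z by (simp add: field_simps)
    finally show "z * ?B \<le> ?A"
      using z by (simp add: zero_le_mult_iff)
  qed
  have all_v: "(norm (D1 *v v))\<^sup>2 = (norm (D2 *v v))\<^sup>2" for v
  proof (cases "v = 0")
    case False
    then have "norm ((1 / norm v) *\<^sub>R v) = 1" by simp
    from le[OF this] show ?thesis
      using False by (simp add: matrix_vector_mult_scaleR power_mult_distrib)
  qed simp
  have "transpose D1 ** D1 - transpose D2 ** D2 = 0"
  proof (rule symmetric_form_zero)
    show "transpose (transpose D1 ** D1 - transpose D2 ** D2) = transpose D1 ** D1 - transpose D2 ** D2"
      by (simp add: matrix_distribs)
    show "v \<bullet> ((transpose D1 ** D1 - transpose D2 ** D2) *v v) = 0" for v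
      by (simp add: matrix_vector_mult_diff_rdistrib inner_diff_right gram_quadratic_form all_v)
  qed
  with prod show thesis
    using that by auto
qed

text \<open>
  A balanced factorisation of a positive semidefinite \<open>M\<close> is already symmetric: \<open>N = D1 D1\<^sup>T\<close>
  satisfies \<open>N\<^sup>2 = M M\<^sup>T = M\<^sup>2\<close>, and positive semidefinite square roots are unique.
\<close>
lemma ex_psd_factorization:
  fixes M :: "real^'n^'n"
  assumes M: "M \<in> psd_matrices" and "rank M \<le> CARD('r)"
  obtains D :: "real^'r^'n" where "D ** transpose D = M"
proof -
  obtain D1 D2 :: "real^'r^'n" where D: "D1 ** transpose D2 = M" "transpose D1 ** D1 = transpose D2 ** D2"
    using ex_balanced_factorization[OF assms(2)] by metis
  have M_sym: "transpose M = M" and psd: "\<And>x. 0 \<le> x \<bullet> (M *v x)"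
    using M by (auto simp: psd_matrices_def)
  define N where "N = D1 ** transpose D1"
  have N_sym: "transpose N = N" by (simp add: N_def matrix_transpose_mul)
  have sq: "N ** N = M ** M"
  proof -
    have "M ** M = D1 ** transpose D2 ** transpose (D1 ** transpose D2)"
      using D(1) M_sym by simp
    also have "\<dots> = D1 ** (transpose D2 ** D2) ** transpose D1"
      by (simp add: matrix_transpose_mul matrix_mul_assoc)
    also have "\<dots> = N ** N"
      by (simp add: N_def matrix_mul_assoc flip: D(2))
    finally show ?thesis by simp
  qed
  define K where "K = N - M"
  have K_sym: "transpose K = K" by (simp add: K_def transpose_diff N_sym M_sym)
  \<comment> \<open>This is \<open>2 (N\<^sup>2 - M\<^sup>2)\<close>; paired with \<open>K\<close>, both summands are nonnegative.\<close>
  have "K ** (N + M) + (N + M) ** K = 0"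
    by (simp add: K_def matrix_distribs sq)
  then have "K \<bullet> (K ** (N + M)) + K \<bullet> ((N + M) ** K) = 0"
    by (simp flip: inner_add_right)
  moreover have "K \<bullet> (K ** (N + M)) = (transpose K ** K) \<bullet> (N + M)"
    using inner_mult_left[of K "N + M" K] by (simp add: inner_commute)
  moreover have "K \<bullet> ((N + M) ** K) = (transpose K ** K) \<bullet> (N + M)"
    using inner_mult_right[of "N + M" K K] K_sym by (simp add: inner_commute)
  moreover have "0 \<le> (transpose K ** K) \<bullet> M"
    by (rule inner_gram_psd_nonneg[OF psd])
  moreover have "(transpose K ** K) \<bullet> N = (norm (K ** D1))\<^sup>2"
    using norm_outer_squared[of K "transpose D1"] by (simp add: N_def)
  ultimately have "(norm (K ** D1))\<^sup>2 \<le> 0"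
    using zero_le_power2[of "norm (K ** D1)"] by (simp only: inner_add_right)
  then have KN: "K ** N = 0"
    by (simp add: N_def matrix_mul_assoc)
  then have NK: "N ** K = 0"
    by (metis K_sym N_sym matrix_transpose_mul transpose_transpose transpose_iff times0_left times0_right)
  have "K ** K = K ** N - N ** M + M ** M"
    by (simp add: K_def matrix_distribs)
  also have "\<dots> = N ** K"
    by (simp add: KN) (simp add: K_def matrix_distribs sq)
  finally have "transpose K ** K = 0"
    by (simp add: NK K_sym)
  then have "(norm K)\<^sup>2 = 0"
    using inner_mult_left[of K "mat 1" K] by (simp add: power2_norm_eq_inner)
  then have "D1 ** transpose D1 = M"
    by (simp add: K_def N_def)
  then show thesis by (rule that)
qed

text \<open>
  \<open>Q\<close> maximises the trace of \<open>N Q\<close> over the compact orthogonal group. Comparison with \<open>N Q H\<close>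
  for a reflection \<open>H\<close> gives positivity, and comparison with products of two reflections, which
  are rotations in a plane, gives symmetry.
\<close>
lemma polar_decomposition:
  fixes N :: "real^'r^'r"
  obtains Q :: "real^'r^'r" where "Q ** transpose Q = mat 1"
    "transpose (N ** Q) = N ** Q" "\<And>v. 0 \<le> v \<bullet> ((N ** Q) *v v)"
proof -
  let ?O = "{Q :: real^'r^'r. orthogonal_matrix Q}"
  have "compact ?O"
  proof -
    have "closed ?O"
      unfolding orthogonal_matrix
      by (intro closed_Collect_eq continuous_on_matrix_mult continuous_on_transpose continuous_intros)
    moreover have "norm Q = norm (mat 1 :: real^'r^'r)" if "orthogonal_matrix Q" for Q :: "real^'r^'r"
    proof -
      have "(norm Q)\<^sup>2 = (norm (mat 1 :: real^'r^'r))\<^sup>2"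
        using inner_mult_left[of Q "mat 1" Q] that
        by (simp add: power2_norm_eq_inner orthogonal_matrix)
      then show ?thesis by simp
    qed
    then have "bounded ?O"
      by (auto simp: bounded_iff)
    ultimately show ?thesis
      by (simp add: compact_eq_bounded_closed)
  qed
  moreover have "?O \<noteq> {}"
    using orthogonal_matrix_id by blast
  moreover have "continuous_on ?O (\<lambda>Q. transpose N \<bullet> Q)"
    by (intro continuous_intros)
  ultimately obtain Q where Q: "orthogonal_matrix Q"
    and max: "\<And>R. orthogonal_matrix R \<Longrightarrow> transpose N \<bullet> R \<le> transpose N \<bullet> Q"
    using continuous_attains_sup[of ?O "\<lambda>Q. transpose N \<bullet> Q"] by (metis mem_Collect_eq)
  define h where "h = N ** Q"
  have trace_le: "mat 1 \<bullet> (h ** R) \<le> mat 1 \<bullet> h" if "orthogonal_matrix R" for R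
  proof -
    have "transpose N \<bullet> (Q ** R) \<le> transpose N \<bullet> Q"
      by (rule max[OF orthogonal_matrix_mul[OF Q that]])
    moreover have "mat 1 \<bullet> (N ** S) = transpose N \<bullet> S" for S
      using inner_mult_left[of N S "mat 1"] by (simp add: inner_commute)
    ultimately show ?thesis
      by (simp add: h_def flip: matrix_mul_assoc)
  qed
  define H :: "real^'r \<Rightarrow> real^'r^'r" where "H w = mat 1 - (2 / (w \<bullet> w)) *\<^sub>R outer_prod w w" for w
  have H: "orthogonal_matrix (H w)" if "w \<noteq> 0" for w
  proof -
    define c where "c = - (2 / (w \<bullet> w))"
    have H_c: "H w = mat 1 + c *\<^sub>R outer_prod w w"
      by (simp add: H_def c_def)
    then have "transpose (H w) = mat 1 + c *\<^sub>R outer_prod w w"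
      by (simp add: transpose_add transpose_scalar transpose_outer_prod)
    then have "transpose (H w) ** H w = mat 1 + (c + c + c * c * (w \<bullet> w)) *\<^sub>R outer_prod w w"
      unfolding H_c by (simp only: mult_id_plus_scaleR[OF outer_prod_square])
    also have "c + c + c * c * (w \<bullet> w) = 0"
      using that by (simp add: c_def field_simps)
    finally show ?thesis
      by (simp add: orthogonal_matrix)
  qed
  have trace_outer: "mat 1 \<bullet> (h ** outer_prod v w) = w \<bullet> (h *v v)" for v w
    by (simp add: mult_outer_prod inner_outer_prod inner_commute)
  have trace_H: "mat 1 \<bullet> (h ** H w) = mat 1 \<bullet> h - (2 / (w \<bullet> w)) * (w \<bullet> (h *v w))" for w
    by (simp add: H_def matrix_diff_ldistrib matrix_scaleR_right inner_diff_right trace_outer)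
  have psd: "0 \<le> v \<bullet> (h *v v)" for v
  proof (cases "v = 0")
    case False
    then have "0 \<le> (2 / (v \<bullet> v)) * (v \<bullet> (h *v v))"
      using trace_le[OF H[OF False]] trace_H[of v] by simp
    moreover have "0 < 2 / (v \<bullet> v)"
      using False by simp
    ultimately show ?thesis
      by (simp only: zero_le_mult_iff) linarith
  qed simp
  have skew_le: "axis j 1 \<bullet> (h *v axis i 1) - axis i 1 \<bullet> (h *v axis j 1) \<le> 0" if "i \<noteq> j" for i j
  proof (rule ccontr)
    let ?v = "axis i 1 :: real^'r" and ?z = "axis j 1 :: real^'r"
    define c where "c = ?z \<bullet> (h *v ?v) - ?v \<bullet> (h *v ?z)"
    define d where "d = ?v \<bullet> (h *v ?v) + ?z \<bullet> (h *v ?z)"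
    assume "\<not> ?z \<bullet> (h *v ?v) - ?v \<bullet> (h *v ?z) \<le> 0"
    then have c: "0 < c" by (simp add: c_def)
    have d: "0 \<le> d" by (simp add: d_def psd)
    define e where "e = c / (2 * (d + 1))"
    have e: "0 < e" using c d by (simp add: e_def)
    \<comment> \<open>A rotation by a small angle of order \<open>e\<close>; its first-order gain \<open>e c\<close> beats the second-order loss.\<close>
    define w where "w = ?v + e *\<^sub>R ?z"
    have vz: "?v \<bullet> ?v = 1" "?z \<bullet> ?z = 1" "?v \<bullet> ?z = 0" "?z \<bullet> ?v = 0"
      using that by (simp_all add: inner_axis_axis)
    have ww: "w \<bullet> w = 1 + e\<^sup>2"
      by (simp add: w_def inner_simps vz power2_eq_square)
    then have w0: "0 < w \<bullet> w" by (simp add: add_pos_nonneg)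
    have v0: "?v \<noteq> 0" and "w \<noteq> 0" using w0 by auto
    then have "mat 1 \<bullet> (h ** (H ?v ** H w)) \<le> mat 1 \<bullet> h"
      by (intro trace_le orthogonal_matrix_mul H)
    moreover have "H ?v ** H w = H ?v + H w - mat 1 + (4 / (w \<bullet> w)) *\<^sub>R outer_prod ?v w"
    proof -
      have "outer_prod ?v ?v ** outer_prod w w = outer_prod ?v w"
        by (simp add: mult_outer_prod outer_prod_mult_vector w_def inner_simps vz)
      then show ?thesis
        by (simp add: H_def matrix_distribs vz algebra_simps)
    qed
    ultimately have "(4 / (w \<bullet> w)) * (w \<bullet> (h *v ?v)) \<le> 2 * (?v \<bullet> (h *v ?v)) + (2 / (w \<bullet> w)) * (w \<bullet> (h *v w))"
      using trace_H[of ?v] trace_H[of w] 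
      by (simp add: matrix_add_ldistrib matrix_diff_ldistrib matrix_scaleR_right inner_simps trace_outer vz)
    then have "2 * (w \<bullet> (h *v ?v)) \<le> (w \<bullet> w) * (?v \<bullet> (h *v ?v)) + (w \<bullet> (h *v w))"
      using w0 by (simp add: field_simps)
    then have "e * c \<le> e * (e * d)"
      unfolding ww by (simp add: w_def c_def d_def inner_simps matrix_vector_right_distrib
          matrix_vector_mult_scaleR algebra_simps power2_eq_square)
    then have "c \<le> e * d"
      using e by simp
    also have "e * d < c"
      using c d by (simp add: e_def field_simps)
        (metis add_pos_nonneg add_strict_increasing2 mult_nonneg_nonneg less_imp_le mult_pos_pos zero_less_numeral)
    finally show False by simp
  qed
  have "h$i$j = h$j$i" for i j
  proof (cases "i = j")
    case False
    then show ?thesis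
      using skew_le[of i j] skew_le[of j i]
      by (simp add: matrix_vector_mult_basis inner_axis' column_def)
  qed simp
  then have "transpose h = h"
    by (simp add: transpose_def vec_eq_iff)
  moreover have "Q ** transpose Q = mat 1"
    using Q by (simp add: orthogonal_matrix_def)
  ultimately show thesis
    using psd that by (simp add: h_def)
qed

lemma mult_transpose_self_eq_0:
  fixes C :: "real^'n^'m"
  assumes "C ** transpose C = 0"
  shows "C = 0"
proof -
  have "(norm C)\<^sup>2 = 0"
    using inner_mult_right[of "mat 1" C C] assms
    by (simp add: power2_norm_eq_inner)
  then show ?thesis by simp
qed

text \<open>
  The range of \<open>D1\<close> is contained in that of \<open>D1 D2\<^sup>T\<close>: balancing turns \<open>D2\<^sup>T D2\<close> into \<open>D1\<^sup>T D1\<close>,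
  so whatever annihilates \<open>D1 D2\<^sup>T\<close> from the left annihilates \<open>D1 D1\<^sup>T D1\<close> and hence \<open>D1\<close>.
\<close>
lemma balanced_factor_left:
  fixes D1 :: "real^'r^'n" and D2 :: "real^'r^'m"
  assumes bal: "transpose D1 ** D1 = transpose D2 ** D2"
  obtains K where "D1 = (D1 ** transpose D2) ** K"
proof -
  let ?M = "D1 ** transpose D2"
  obtain P :: "real^'n^'n" and Z where P: "transpose P = P" "P ** ?M = ?M" "P = ?M ** Z"
    using range_projector[of ?M] by metis
  define C where "C = D1 - P ** D1"
  have "C ** transpose D2 = 0"
    using P(2) by (simp add: C_def matrix_diff_rdistrib matrix_mul_assoc)
  then have "C ** (transpose D2 ** D2) = 0"
    by (simp add: matrix_mul_assoc)
  then have "C ** transpose D1 ** D1 = 0"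
    by (simp add: matrix_mul_assoc flip: bal)
  then have "(C ** transpose D1) ** transpose (C ** transpose D1) = 0"
    by (simp add: matrix_transpose_mul matrix_mul_assoc)
  then have CD: "C ** transpose D1 = 0"
    by (rule mult_transpose_self_eq_0)
  have "C ** transpose C = C ** transpose D1 - C ** transpose D1 ** P"
    by (simp add: C_def transpose_diff matrix_diff_ldistrib matrix_transpose_mul P(1) matrix_mul_assoc)
  then have "C ** transpose C = 0"
    by (simp add: CD)
  then have "C = 0"
    by (rule mult_transpose_self_eq_0)
  then have "D1 = ?M ** (Z ** D1)"
    using P(3) by (simp add: C_def matrix_mul_assoc)
  then show thesis by (rule that)
qed

lemma balanced_factor_right:
  fixes D1 :: "real^'r^'n" and D2 :: "real^'r^'m"
  assumes bal: "transpose D1 ** D1 = transpose D2 ** D2"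
  obtains K where "transpose D2 = K ** (D1 ** transpose D2)"
proof -
  obtain K where "D2 = (D2 ** transpose D1) ** K"
    using balanced_factor_left[OF bal[symmetric]] .
  then have "transpose D2 = transpose (D2 ** transpose D1 ** K)"
    by simp
  then have "transpose D2 = transpose K ** (D1 ** transpose D2)"
    by (simp add: matrix_transpose_mul)
  then show thesis by (rule that)
qed

section \<open>Stacking two factors\<close>

definition stack :: "real^'r^'a \<Rightarrow> real^'r^'b \<Rightarrow> real^'r^('a::finite + 'b::finite)" where
  "stack U V = (\<chi> i. case i of Inl a \<Rightarrow> U$a | Inr b \<Rightarrow> V$b)"

text \<open>
  The symmetric dilation \<open>[0, \<Xi>; \<Xi>\<^sup>T, 0]\<close>.
\<close>
definition off_diagonal :: "real^'b^'a \<Rightarrow> real^('a::finite + 'b::finite)^('a + 'b)" where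
  "off_diagonal \<Xi> = (\<chi> i j. case i of
      Inl a \<Rightarrow> (case j of Inl _ \<Rightarrow> 0 | Inr b \<Rightarrow> \<Xi>$a$b)
    | Inr b \<Rightarrow> (case j of Inl a \<Rightarrow> \<Xi>$a$b | Inr _ \<Rightarrow> 0))"

lemma sum_over_sum_type:
  "(\<Sum>i\<in>UNIV. f i) = (\<Sum>a\<in>UNIV. f (Inl a)) + (\<Sum>b\<in>UNIV. f (Inr b))"
  for f :: "'a::finite + 'b::finite \<Rightarrow> 'c::comm_monoid_add"
  by (subst UNIV_Plus_UNIV[symmetric], subst sum.Plus) simp_all

lemma inner_stack: "stack U V \<bullet> stack U' V' = U \<bullet> U' + V \<bullet> V'"
  by (simp add: inner_vec_def stack_def sum_over_sum_type)

lemma stack_diff: "stack U V - stack U' V' = stack (U - U') (V - V')"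
  by (auto simp: stack_def vec_eq_iff split: sum.split)

lemma gram_stack: "transpose (stack U V) ** stack U' V' = transpose U ** U' + transpose V ** V'"
  by (simp add: matrix_matrix_mult_def transpose_def stack_def vec_eq_iff sum_over_sum_type)

lemma stack_mult: "stack U V ** K = stack (U ** K) (V ** K)"
  by (auto simp: matrix_matrix_mult_def stack_def vec_eq_iff split: sum.split)

lemma off_diagonal_mult_stack: "off_diagonal \<Xi> ** stack U V = stack (\<Xi> ** V) (transpose \<Xi> ** U)"
  by (auto simp: matrix_matrix_mult_def stack_def off_diagonal_def transpose_def vec_eq_iff
      sum_over_sum_type split: sum.split)

lemma transpose_off_diagonal: "transpose (off_diagonal \<Xi>) = off_diagonal \<Xi>"
  by (auto simp: off_diagonal_def transpose_def vec_eq_iff split: sum.split)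

lemma inner_off_diagonal_stack:
  "off_diagonal \<Xi> \<bullet> (stack U V ** transpose (stack U V)) = 2 * (\<Xi> \<bullet> (U ** transpose V))"
proof -
  have "off_diagonal \<Xi> \<bullet> (stack U V ** transpose (stack U V)) = (off_diagonal \<Xi> ** stack U V) \<bullet> stack U V"
    by (simp add: inner_mult_right)
  also have "\<dots> = (\<Xi> ** V) \<bullet> U + (transpose \<Xi> ** U) \<bullet> V"
    by (simp add: off_diagonal_mult_stack inner_stack)
  also have "(\<Xi> ** V) \<bullet> U = \<Xi> \<bullet> (U ** transpose V)"
    by (rule inner_mult_right)
  also have "(transpose \<Xi> ** U) \<bullet> V = \<Xi> \<bullet> (U ** transpose V)"
    by (simp add: inner_mult_right inner_transpose_left matrix_transpose_mul)
  finally show ?thesis by simp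
qed

lemma norm_off_diagonal_le:
  fixes \<Xi> :: "real^'b^'a"
  assumes "\<And>x. norm (\<Xi> *v x) \<le> c * norm x"
  shows "norm (off_diagonal \<Xi> *v x) \<le> c * norm x"
proof -
  define x1 :: "real^'a" where "x1 = (\<chi> a. x $ Inl a)"
  define x2 :: "real^'b" where "x2 = (\<chi> b. x $ Inr b)"
  have nonneg: "0 \<le> c"
    using order_trans[OF norm_ge_zero assms[of "axis (SOME i. True) 1"]] by simp
  have x: "(norm x)\<^sup>2 = (norm x1)\<^sup>2 + (norm x2)\<^sup>2"
    by (simp add: power2_norm_eq_inner inner_vec_def sum_over_sum_type x1_def x2_def)
  have "(off_diagonal \<Xi> *v x) $ Inl a = (\<Xi> *v x2) $ a" "(off_diagonal \<Xi> *v x) $ Inr b = (transpose \<Xi> *v x1) $ b" for a b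
    by (simp_all add: off_diagonal_def matrix_vector_mult_def x1_def x2_def transpose_def sum_over_sum_type del: transpose_matrix_vector)
  then have "(norm (off_diagonal \<Xi> *v x))\<^sup>2 = (norm (\<Xi> *v x2))\<^sup>2 + (norm (transpose \<Xi> *v x1))\<^sup>2"
    by (simp add: power2_norm_eq_inner inner_vec_def[where 'b = "'a + 'b"] sum_over_sum_type del: transpose_matrix_vector)
      (simp add: inner_vec_def del: transpose_matrix_vector)
  also have "\<dots> \<le> (c * norm x2)\<^sup>2 + (c * norm x1)\<^sup>2"
    by (intro add_mono power_mono assms norm_transpose_mult_vector_le) simp_all
  also have "\<dots> = (c * norm x)\<^sup>2"
    by (simp add: power_mult_distrib x algebra_simps)
  finally show ?thesis
    by (rule power2_le_imp_le) (simp add: nonneg)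
qed

section \<open>The error bound at a balanced critical pair\<close>

text \<open>
  \<open>s\<close> is the derivative of the data term with respect to \<open>M\<close>. The first-order condition in the
  directions \<open>(D1, D2)\<close> and \<open>(U, V)\<close> evaluates \<open>s\<close> on \<open>W + 2 M\<^sub>0\<close> and on \<open>M\<close>. Without noise and
  regularisation this says \<open>s W = 2 s E\<close>, that is, \<open>\<langle>f E, f W\<rangle> = 2 \<parallel>f E\<parallel>\<^sup>2\<close>, so that
  \<open>\<parallel>f (W - 2 E)\<parallel>\<^sup>2\<close> is \<open>\<parallel>f W\<parallel>\<^sup>2 - 4 \<parallel>f E\<parallel>\<^sup>2\<close>, while the curvature term of the second-order
  condition is \<open>- 2 \<parallel>f E\<parallel>\<^sup>2\<close>.
\<close>
lemma tangent_energy_bound: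
  fixes f :: "real^'b^'a \<Rightarrow> 'e::real_inner" and \<xi> :: 'e
    and U D1 :: "real^'r^'a" and V D2 :: "real^'r^'b"
  assumes f: "linear f"
    and \<Xi>: "\<And>N. \<xi> \<bullet> f N = \<Xi> \<bullet> N"
  defines "M \<equiv> U ** transpose V" and "M\<^sub>0 \<equiv> D1 ** transpose D2"
  defines "s \<equiv> \<lambda>N. (f (M - M\<^sub>0) - \<xi>) \<bullet> f N"
  assumes crit1: "s (U ** transpose D2 + D1 ** transpose V) + lam * (U \<bullet> D1 + V \<bullet> D2) = 0"
    and crit2: "2 * s M + lam * ((norm U)\<^sup>2 + (norm V)\<^sup>2) = 0"
    and hess: "0 \<le> (norm (f (U ** transpose (D2 - V) + (D1 - U) ** transpose V)))\<^sup>2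
        + 2 * s ((D1 - U) ** transpose (D2 - V)) + lam * ((norm (D1 - U))\<^sup>2 + (norm (D2 - V))\<^sup>2)"
  defines "W \<equiv> U ** transpose D2 + D1 ** transpose V - 2 *\<^sub>R M\<^sub>0"
  defines "u \<equiv> ((norm U)\<^sup>2 + (norm V)\<^sup>2) / 2" and "n \<equiv> ((norm D1)\<^sup>2 + (norm D2)\<^sup>2) / 2"
  shows "6 * (norm (f (M - M\<^sub>0)))\<^sup>2 \<le> (norm (f W))\<^sup>2 + 10 * (\<Xi> \<bullet> (M - M\<^sub>0) - lam * (u - n))
      - 4 * (\<Xi> \<bullet> W) + 4 * lam * (U \<bullet> D1 + V \<bullet> D2 - 2 * n)"
proof -
  define E where "E = M - M\<^sub>0"
  define T where "T = U ** transpose D2 + D1 ** transpose V"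
  have f_simps: "f (A + B) = f A + f B" "f (A - B) = f A - f B" "f (c *\<^sub>R A) = c *\<^sub>R f A" for A B c
    using f by (simp_all add: linear_add linear_diff linear_scale)
  have s: "s N = f E \<bullet> f N - \<Xi> \<bullet> N" for N
    by (simp add: s_def E_def inner_diff_left \<Xi>)
  have s_simps: "s (A + B) = s A + s B" "s (A - B) = s A - s B" "s (c *\<^sub>R A) = c * s A" for A B c
    by (simp_all add: s_def f_simps inner_add_right inner_diff_right)
  have direction: "U ** transpose (D2 - V) + (D1 - U) ** transpose V = W - 2 *\<^sub>R E"
    by (simp add: W_def E_def M_def M\<^sub>0_def matrix_distribs scaleR_2 algebra_simps)
  have second: "(D1 - U) ** transpose (D2 - V) = M + M\<^sub>0 - T"
    by (simp add: T_def M_def M\<^sub>0_def matrix_distribs algebra_simps)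
  have W: "W = T - 2 *\<^sub>R M\<^sub>0"
    by (simp add: W_def T_def)
  have "(norm (f (W - 2 *\<^sub>R E)))\<^sup>2 = (norm (f W))\<^sup>2 - 4 * (f E \<bullet> f W) + 4 * (norm (f E))\<^sup>2"
    by (simp add: f_simps power2_norm_eq_inner inner_simps inner_commute)
  moreover have "s E = (norm (f E))\<^sup>2 - \<Xi> \<bullet> E" "s W = f E \<bullet> f W - \<Xi> \<bullet> W"
    by (simp_all add: s power2_norm_eq_inner)
  moreover have "s E = s M - s M\<^sub>0" "s W = s T - 2 * s M\<^sub>0"
    by (simp_all add: E_def W s_simps)
  moreover have "s T = - lam * (U \<bullet> D1 + V \<bullet> D2)" "2 * s M = - 2 * (lam * u)"
    using crit1 crit2 by (simp_all add: T_def u_def)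
  moreover have "lam * ((norm (D1 - U))\<^sup>2 + (norm (D2 - V))\<^sup>2)
      = 2 * (lam * u) + 2 * (lam * n) - 2 * lam * (U \<bullet> D1 + V \<bullet> D2)"
    by (simp add: power2_norm_eq_inner inner_simps inner_commute u_def n_def field_simps)
  ultimately show ?thesis
    using hess unfolding direction second s_simps E_def[symmetric]
    by (simp add: algebra_simps)
qed

text \<open>
  The blocks of \<open>E' = X X\<^sup>T - D D\<^sup>T\<close> and of its linearisation \<open>W'\<close> are compared through Gram
  matrices. With \<open>K = t1 - t2\<close> measuring how far the two factors are from being aligned
  separately, balancing gives \<open>4 \<parallel>E\<parallel>\<^sup>2 = \<parallel>E'\<parallel>\<^sup>2 + 2 \<parallel>K\<parallel>\<^sup>2\<close> and \<open>4 \<parallel>W\<parallel>\<^sup>2 = \<parallel>W'\<parallel>\<^sup>2 - 2 \<langle>K\<^sup>T, K\<rangle>\<close>,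
  so the defect \<open>K\<close> is absorbed because \<open>2 + sqrt 5 \<ge> 1\<close>.
\<close>
lemma balanced_linearisation_bound:
  fixes U D1 :: "real^'r^'a" and V D2 :: "real^'r^'b"
  assumes bal: "transpose U ** U = transpose V ** V" and bal0: "transpose D1 ** D1 = transpose D2 ** D2"
  defines "X \<equiv> stack U V" and "D \<equiv> stack D1 D2"
  assumes sym: "transpose (transpose X ** D) = transpose X ** D"
    and psd: "\<And>v. 0 \<le> v \<bullet> ((transpose X ** D) *v v)"
  defines "E \<equiv> U ** transpose V - D1 ** transpose D2"
    and "W \<equiv> U ** transpose D2 + D1 ** transpose V - 2 *\<^sub>R (D1 ** transpose D2)"
  shows "norm (X ** transpose X - D ** transpose D) \<le> 2 * norm E"
    and "(norm W)\<^sup>2 \<le> (2 + sqrt 5) * (norm E)\<^sup>2"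
    and "(norm (transpose D ** (X - D)))\<^sup>2 \<le> 2 * (2 + sqrt 5) * (norm E)\<^sup>2"
proof -
  define \<Delta>1 where "\<Delta>1 = U - D1"
  define \<Delta>2 where "\<Delta>2 = V - D2"
  define a where "a = transpose D1 ** D1"
  define g where "g = transpose U ** U"
  define p where "p = transpose U ** D1"
  define q where "q = transpose V ** D2"
  define t1 where "t1 = transpose D1 ** \<Delta>1"
  define t2 where "t2 = transpose D2 ** \<Delta>2"
  define E' where "E' = X ** transpose X - D ** transpose D"
  define W' where "W' = (X - D) ** transpose D + D ** transpose (X - D)"
  have pq: "norm (p - q) = norm (t1 - t2)"
  proof -
    have "t1 - t2 = transpose (p - q)"
      by (simp add: t1_def t2_def p_def q_def \<Delta>1_def \<Delta>2_def matrix_distribs bal0)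
    then show ?thesis by (simp add: norm_transpose)
  qed
  have "(norm E')\<^sup>2 = 4 * (norm g)\<^sup>2 + 4 * (norm a)\<^sup>2 - 2 * (norm (p + q))\<^sup>2"
  proof -
    have "transpose X ** X = 2 *\<^sub>R g" "transpose D ** D = 2 *\<^sub>R a" "transpose X ** D = p + q"
      by (simp_all add: X_def D_def gram_stack g_def a_def p_def q_def scaleR_2 bal bal0)
    then show ?thesis
      by (simp add: E'_def norm_gram_diff power_mult_distrib)
  qed
  moreover have "(norm E)\<^sup>2 = (norm g)\<^sup>2 + (norm a)\<^sup>2 - 2 * (p \<bullet> q)"
    using inner_transpose[of "transpose U ** D1" "transpose V ** D2"]
    by (simp add: E_def power2_norm_eq_inner inner_diff_left inner_diff_right inner_gram
        g_def a_def p_def q_def bal bal0 matrix_transpose_mul)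
  moreover have "(norm (p - q))\<^sup>2 + 4 * (p \<bullet> q) = (norm (p + q))\<^sup>2"
    by (simp add: power2_norm_eq_inner inner_simps inner_commute)
  moreover have "(norm (p - q))\<^sup>2 + 2 * (p \<bullet> q) = (norm p)\<^sup>2 + (norm q)\<^sup>2"
    by (simp add: power2_norm_eq_inner inner_simps inner_commute)
  ultimately have E_eq: "4 * (norm E)\<^sup>2 = (norm E')\<^sup>2 + 2 * (norm (t1 - t2))\<^sup>2"
    unfolding pq[symmetric] by simp
  have "(norm W)\<^sup>2 = (transpose \<Delta>1 ** \<Delta>1 + transpose \<Delta>2 ** \<Delta>2) \<bullet> a + 2 * (transpose t1 \<bullet> t2)"
  proof -
    have W: "W = \<Delta>1 ** transpose D2 + D1 ** transpose \<Delta>2"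
      by (simp add: W_def \<Delta>1_def \<Delta>2_def matrix_distribs scaleR_2)
    have "(\<Delta>1 ** transpose D2) \<bullet> (D1 ** transpose \<Delta>2) = transpose t1 \<bullet> t2"
      by (simp add: inner_gram t1_def t2_def matrix_transpose_mul)
    moreover have "(norm (\<Delta>1 ** transpose D2))\<^sup>2 = (transpose \<Delta>1 ** \<Delta>1) \<bullet> a"
      by (simp add: norm_outer_squared a_def bal0)
    moreover have "(norm (D1 ** transpose \<Delta>2))\<^sup>2 = (transpose \<Delta>2 ** \<Delta>2) \<bullet> a"
      by (simp add: norm_outer_squared a_def inner_commute)
    moreover have "(norm W)\<^sup>2 = (norm (\<Delta>1 ** transpose D2))\<^sup>2 + (norm (D1 ** transpose \<Delta>2))\<^sup>2
        + 2 * ((\<Delta>1 ** transpose D2) \<bullet> (D1 ** transpose \<Delta>2))"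
      unfolding W by (simp add: power2_norm_eq_inner inner_simps inner_commute)
    ultimately show ?thesis
      by (simp add: inner_add_left)
  qed
  moreover have "(norm W')\<^sup>2 = 4 * ((transpose \<Delta>1 ** \<Delta>1 + transpose \<Delta>2 ** \<Delta>2) \<bullet> a)
      + 2 * (transpose (t1 + t2) \<bullet> (t1 + t2))"
  proof -
    have \<Delta>: "X - D = stack \<Delta>1 \<Delta>2"
      by (simp add: X_def D_def stack_diff \<Delta>1_def \<Delta>2_def)
    have grams: "transpose (X - D) ** (X - D) = transpose \<Delta>1 ** \<Delta>1 + transpose \<Delta>2 ** \<Delta>2"
        "transpose D ** D = 2 *\<^sub>R a" "transpose D ** (X - D) = t1 + t2"
      unfolding \<Delta> by (simp_all add: D_def gram_stack a_def bal0 scaleR_2 t1_def t2_def)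
    then have grams': "transpose (X - D) ** D = transpose (t1 + t2)"
      by (metis matrix_transpose_mul transpose_transpose)
    have "(norm W')\<^sup>2 = 2 * (norm ((X - D) ** transpose D))\<^sup>2
        + 2 * (((X - D) ** transpose D) \<bullet> (D ** transpose (X - D)))"
      using norm_add_transpose[of "(X - D) ** transpose D"] by (simp add: W'_def matrix_transpose_mul)
    moreover have "(norm ((X - D) ** transpose D))\<^sup>2 = (transpose \<Delta>1 ** \<Delta>1 + transpose \<Delta>2 ** \<Delta>2) \<bullet> (2 *\<^sub>R a)"
      by (simp add: norm_outer_squared grams)
    moreover have "((X - D) ** transpose D) \<bullet> (D ** transpose (X - D)) = transpose (t1 + t2) \<bullet> (t1 + t2)"
      by (simp add: inner_gram grams grams')
    ultimately show ?thesis by simp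
  qed
  moreover have "transpose (t1 - t2) \<bullet> (t1 - t2) + 4 * (transpose t1 \<bullet> t2) = transpose (t1 + t2) \<bullet> (t1 + t2)"
    using inner_transpose_left[of t2 t1]
    by (simp add: transpose_diff transpose_add inner_simps inner_commute)
  moreover have "- (transpose (t1 - t2) \<bullet> (t1 - t2)) \<le> (norm (t1 - t2))\<^sup>2"
    using Cauchy_Schwarz_ineq2[of "transpose (t1 - t2)" "t1 - t2"]
    by (simp add: norm_transpose power2_eq_square abs_le_iff)
  ultimately have W_le: "4 * (norm W)\<^sup>2 \<le> (norm W')\<^sup>2 + 2 * (norm (t1 - t2))\<^sup>2"
    by linarith
  have key: "(norm W')\<^sup>2 \<le> (2 + sqrt 5) * (norm E')\<^sup>2" "2 * (norm (transpose D ** (X - D)))\<^sup>2 \<le> (norm W')\<^sup>2"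
    using aligned_linearisation_bound[OF sym psd] by (simp_all add: W'_def E'_def)
  have E'_le: "(norm E')\<^sup>2 \<le> 4 * (norm E)\<^sup>2"
    using E_eq zero_le_power2[of "norm (t1 - t2)"] by linarith
  show "norm E' \<le> 2 * norm E"
    by (rule power2_le_imp_le) (use E'_le in \<open>simp_all add: power_mult_distrib\<close>)
  have "1 * (2 * (norm (t1 - t2))\<^sup>2) \<le> (2 + sqrt 5) * (2 * (norm (t1 - t2))\<^sup>2)"
    by (rule mult_right_mono) simp_all
  then have "4 * (norm W)\<^sup>2 \<le> (2 + sqrt 5) * (4 * (norm E)\<^sup>2)"
    using W_le key(1) unfolding E_eq by (simp add: distrib_left)
  then show "(norm W)\<^sup>2 \<le> (2 + sqrt 5) * (norm E)\<^sup>2"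
    by simp
  have "(2 + sqrt 5) * (norm E')\<^sup>2 \<le> (2 + sqrt 5) * (4 * (norm E)\<^sup>2)"
    by (rule mult_left_mono[OF E'_le]) simp
  then show "(norm (transpose D ** (X - D)))\<^sup>2 \<le> 2 * (2 + sqrt 5) * (norm E)\<^sup>2"
    using key by (simp add: algebra_simps)
qed

text \<open>
  Balanced factors have the same kernel, so both are unchanged by the projector onto the row
  space of \<open>D1\<close>.
\<close>
lemma rank_stack_balanced_le:
  fixes D1 :: "real^'r^'a" and D2 :: "real^'r^'b"
  assumes bal0: "transpose D1 ** D1 = transpose D2 ** D2"
  shows "rank (stack D1 D2) \<le> rank D1"
proof -
  obtain P :: "real^'r^'r" and Z where P: "transpose P = P" "P ** transpose D1 = transpose D1" "P = transpose D1 ** Z"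
    using range_projector[of "transpose D1"] by metis
  have D1: "D1 ** P = D1"
    by (metis P(1,2) matrix_transpose_mul transpose_transpose)
  define C where "C = transpose (D2 - D2 ** P)"
  have "C ** transpose C = (transpose D2 ** D2 - P ** transpose D2 ** D2) - (transpose D2 ** D2 - P ** transpose D2 ** D2) ** P"
    by (simp add: C_def matrix_distribs P(1) matrix_mul_assoc)
  also have "\<dots> = (transpose D1 ** D1 - P ** transpose D1 ** D1) - (transpose D1 ** D1 - P ** transpose D1 ** D1) ** P"
    using bal0 by (simp flip: matrix_mul_assoc)
  also have "\<dots> = 0"
    by (simp add: P(2))
  finally have "C = 0"
    by (rule mult_transpose_self_eq_0)
  then have "D2 ** P = D2"
    by (metis C_def transpose_transpose eq_iff_diff_eq_0 transpose_diff transpose_iff diff_self)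
  then have "stack D1 D2 = stack D1 D2 ** P"
    by (simp add: stack_mult D1)
  then have "rank (stack D1 D2) \<le> rank P"
    by (metis rank_mul_le_right)
  also have "\<dots> \<le> rank D1"
    by (metis P(3) rank_mul_le_left rank_transpose)
  finally show ?thesis .
qed

text \<open>
  The numbers: \<open>10\<close> multiplies the noise on \<open>E\<close>, where \<open>E = M - M\<^sub>0\<close>, which gives the
  \<open>max (c - lam) 0\<close> term and \<open>20 lam\<close>; \<open>4 sqrt 2 sqrt (2 + sqrt 5) \<le> 12\<close> comes from \<open>4 \<langle>\<Xi>, W\<rangle>\<close>
  with \<open>rank W \<le> 2 rank M\<^sub>0\<close>; and \<open>4 sqrt (2 (2 + sqrt 5)) \<le> 16\<close> from the last term of
  \<open>tangent_energy_bound\<close>, the trace of a matrix of rank at most \<open>rank M\<^sub>0\<close>. Together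
  \<open>20 + 16 = 36\<close>.
\<close>
lemma critical_point_error_bound:
  fixes f :: "real^'b^'a \<Rightarrow> 'e::real_inner" and \<xi> :: 'e
    and U D1 :: "real^'r^'a" and V D2 :: "real^'r^'b"
  assumes f: "linear f"
    and \<Xi>: "\<And>N. \<xi> \<bullet> f N = \<Xi> \<bullet> N"
    and c: "\<And>x. norm (\<Xi> *v x) \<le> c * norm x"
    and lam: "0 \<le> lam" and \<beta>: "0 \<le> \<beta>"
  defines "M \<equiv> U ** transpose V" and "M\<^sub>0 \<equiv> D1 ** transpose D2"
  defines "s \<equiv> \<lambda>N. (f (M - M\<^sub>0) - \<xi>) \<bullet> f N"
  assumes bal: "transpose U ** U = transpose V ** V" and bal0: "transpose D1 ** D1 = transpose D2 ** D2"
    and sym: "transpose (transpose U ** D1 + transpose V ** D2) = transpose U ** D1 + transpose V ** D2"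
    and psd: "\<And>v. 0 \<le> v \<bullet> ((transpose U ** D1 + transpose V ** D2) *v v)"
    and crit1: "s (U ** transpose D2 + D1 ** transpose V) + lam * (U \<bullet> D1 + V \<bullet> D2) = 0"
    and crit2: "2 * s M + lam * ((norm U)\<^sup>2 + (norm V)\<^sup>2) = 0"
    and hess: "0 \<le> (norm (f (U ** transpose (D2 - V) + (D1 - U) ** transpose V)))\<^sup>2
        + 2 * s ((D1 - U) ** transpose (D2 - V)) + lam * ((norm (D1 - U))\<^sup>2 + (norm (D2 - V))\<^sup>2)"
    and lower: "\<alpha> * (norm (M - M\<^sub>0))\<^sup>2 \<le> (norm (f (M - M\<^sub>0)))\<^sup>2"
    and upper: "(norm (f (U ** transpose D2 + D1 ** transpose V - 2 *\<^sub>R M\<^sub>0)))\<^sup>2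
        \<le> \<beta> * (norm (U ** transpose D2 + D1 ** transpose V - 2 *\<^sub>R M\<^sub>0))\<^sup>2"
  shows "(6 * \<alpha> - (sqrt 5 + 2) * \<beta>) * norm (M - M\<^sub>0)
      \<le> (36 * lam + 12 * c) * sqrt (real (rank M\<^sub>0)) + 10 * sqrt (real (CARD('r) + rank M\<^sub>0)) * max (c - lam) 0"
proof -
  define e where "e = norm (M - M\<^sub>0)"
  define W where "W = U ** transpose D2 + D1 ** transpose V - 2 *\<^sub>R M\<^sub>0"
  define X where "X = stack U V"
  define D where "D = stack D1 D2"
  define E' where "E' = X ** transpose X - D ** transpose D"
  define k where "k = rank M\<^sub>0"
  define u where "u = ((norm U)\<^sup>2 + (norm V)\<^sup>2) / 2"
  define n where "n = ((norm D1)\<^sup>2 + (norm D2)\<^sup>2) / 2"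
  define w where "w = U \<bullet> D1 + V \<bullet> D2"
  have c0: "0 \<le> c"
    using order_trans[OF norm_ge_zero c[of "axis (SOME i. True) 1"]] by simp
  have s5: "sqrt 5 \<le> 5/2"
    by (rule real_le_lsqrt) (simp_all add: power2_eq_square)
  have ranks: "rank D1 \<le> k" "rank D2 \<le> k"
  proof -
    show "rank D1 \<le> k"
      unfolding k_def M\<^sub>0_def by (metis balanced_factor_left[OF bal0] rank_mul_le_left)
    show "rank D2 \<le> k"
      unfolding k_def M\<^sub>0_def by (metis balanced_factor_right[OF bal0] rank_mul_le_right rank_transpose)
  qed
  have rankD: "rank D \<le> k"
    using rank_stack_balanced_le[OF bal0] ranks by (simp add: D_def)
  have XD: "transpose X ** D = transpose U ** D1 + transpose V ** D2"
    by (simp add: X_def D_def gram_stack)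
  have E'_le: "norm E' \<le> 2 * e" and W_le: "(norm W)\<^sup>2 \<le> (2 + sqrt 5) * e\<^sup>2"
    and T_le: "(norm (transpose D ** (X - D)))\<^sup>2 \<le> 2 * (2 + sqrt 5) * e\<^sup>2"
    using balanced_linearisation_bound[OF bal bal0] sym psd
    unfolding XD[unfolded X_def D_def] by (simp_all add: X_def D_def E'_def e_def W_def M_def M\<^sub>0_def)
  have energy: "6 * (norm (f (M - M\<^sub>0)))\<^sup>2 \<le> (norm (f W))\<^sup>2 + 10 * (\<Xi> \<bullet> (M - M\<^sub>0) - lam * (u - n))
      - 4 * (\<Xi> \<bullet> W) + 4 * lam * (w - 2 * n)"
    unfolding W_def u_def n_def w_def M_def M\<^sub>0_def
    by (rule tangent_energy_bound[OF f \<Xi>]) (use crit1 crit2 hess in \<open>simp_all add: s_def M_def M\<^sub>0_def\<close>)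
  have noise: "10 * (\<Xi> \<bullet> (M - M\<^sub>0) - lam * (u - n))
      \<le> (10 * (max (c - lam) 0 * sqrt (real (CARD('r) + k))) + 20 * lam * sqrt (real k)) * e"
  proof -
    let ?N = "max (c - lam) 0 * sqrt (real (CARD('r) + k)) + 2 * lam * sqrt (real k)"
    have "mat 1 \<bullet> (Y ** transpose Y) = (norm Y)\<^sup>2" for Y :: "real^'r^('a + 'b)"
      using inner_mult_right[of "mat 1" Y Y] by (simp add: power2_norm_eq_inner)
    then have "mat 1 \<bullet> E' = 2 * (u - n)"
      by (simp add: E'_def inner_diff_right X_def D_def power2_norm_eq_inner inner_stack u_def n_def field_simps)
    moreover have "off_diagonal \<Xi> \<bullet> E' = 2 * (\<Xi> \<bullet> (M - M\<^sub>0))"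
      by (simp add: E'_def inner_diff_right X_def D_def inner_off_diagonal_stack M_def M\<^sub>0_def)
    ultimately have "10 * (\<Xi> \<bullet> (M - M\<^sub>0) - lam * (u - n)) = 5 * ((off_diagonal \<Xi> - lam *\<^sub>R mat 1) \<bullet> E')"
      by (simp only: inner_diff_left inner_scaleR_left) (simp add: algebra_simps)
    also have "\<dots> \<le> 5 * (?N * norm E')"
      unfolding E'_def
      by (intro mult_left_mono regularised_noise_bound norm_off_diagonal_le transpose_off_diagonal c c0 lam rankD) simp
    also have "\<dots> \<le> 5 * (?N * (2 * e))"
      by (intro mult_left_mono E'_le) (use lam in simp_all)
    finally show ?thesis
      by (simp add: algebra_simps)
  qed
  have tangent_noise: "- 4 * (\<Xi> \<bullet> W) \<le> 12 * c * sqrt (real k) * e"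
  proof -
    have "W = U ** transpose D2 + D1 ** transpose (V - 2 *\<^sub>R D2)"
      by (simp add: W_def M\<^sub>0_def matrix_distribs)
    then have "rank W \<le> rank (U ** transpose D2) + rank (D1 ** transpose (V - 2 *\<^sub>R D2))"
      by (simp only: rank_add_le)
    also have "\<dots> \<le> rank (transpose D2) + rank D1"
      by (intro add_mono rank_mul_le_left rank_mul_le_right)
    finally have "rank W \<le> 2 * k"
      using ranks by (simp add: rank_transpose)
    then have "sqrt (real (rank W)) \<le> sqrt (2 * real k)"
      by simp
    moreover have "4 * (sqrt (2 * real k) * norm W) \<le> 12 * (sqrt (real k) * e)"
    proof (rule power2_le_imp_le)
      have "(norm W)\<^sup>2 \<le> (9/2) * e\<^sup>2"
        using W_le s5 mult_right_mono[of "2 + sqrt 5" "9/2" "e\<^sup>2"] by simp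
      then have "(32 * real k) * (norm W)\<^sup>2 \<le> (32 * real k) * ((9/2) * e\<^sup>2)"
        by (rule mult_left_mono) simp
      then show "(4 * (sqrt (2 * real k) * norm W))\<^sup>2 \<le> (12 * (sqrt (real k) * e))\<^sup>2"
        by (simp add: power_mult_distrib)
    qed (simp add: e_def)
    ultimately have "4 * (sqrt (real (rank W)) * norm W) \<le> 12 * (sqrt (real k) * e)"
      by (smt (verit) mult_right_mono norm_ge_zero)
    then have "c * (4 * (sqrt (real (rank W)) * norm W)) \<le> c * (12 * (sqrt (real k) * e))"
      by (rule mult_left_mono[OF _ c0])
    moreover have "- (\<Xi> \<bullet> W) \<le> c * sqrt (real (rank W)) * norm W"
      using inner_le_opnorm_rank[OF c c0, of W] by simp
    ultimately show ?thesis by (simp add: mult_ac)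
  qed
  have overlap: "4 * lam * (w - 2 * n) \<le> 16 * lam * sqrt (real k) * e"
  proof -
    let ?T = "transpose D ** (X - D)"
    have "w - 2 * n = (X - D) \<bullet> D"
      by (simp add: inner_diff_left X_def D_def inner_stack w_def n_def power2_norm_eq_inner field_simps)
    also have "\<dots> = mat 1 \<bullet> ?T"
      using inner_mult_left[of "transpose D" "X - D" "mat 1"] by (simp add: inner_commute)
    also have "\<dots> \<le> 1 * sqrt (real (rank ?T)) * norm ?T"
      using inner_le_opnorm_rank[of "mat 1" 1 ?T] by simp
    also have "\<dots> \<le> sqrt (real k) * (4 * e)"
    proof -
      have "rank ?T \<le> k"
        using rank_mul_le_left[of "transpose D" "X - D"] rankD by (simp add: rank_transpose)
      moreover have "norm ?T \<le> 4 * e"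
      proof (rule power2_le_imp_le)
        have "2 * (2 + sqrt 5) * e\<^sup>2 \<le> 16 * e\<^sup>2"
          using s5 by (intro mult_right_mono) simp_all
        then show "(norm ?T)\<^sup>2 \<le> (4 * e)\<^sup>2"
          using T_le by (simp add: power_mult_distrib)
      qed (simp add: e_def)
      ultimately show ?thesis
        by (simp add: mult_mono e_def)
    qed
    finally have "4 * lam * (w - 2 * n) \<le> 4 * lam * (sqrt (real k) * (4 * e))"
      by (rule mult_left_mono) (use lam in simp)
    then show ?thesis by simp
  qed
  have fW: "(norm (f W))\<^sup>2 \<le> \<beta> * ((2 + sqrt 5) * e\<^sup>2)"
    using upper mult_left_mono[OF W_le \<beta>] by (simp add: W_def)
  let ?R = "(36 * lam + 12 * c) * sqrt (real k) + 10 * sqrt (real (CARD('r) + k)) * max (c - lam) 0"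
  have "6 * (\<alpha> * e\<^sup>2) \<le> \<beta> * ((2 + sqrt 5) * e\<^sup>2) + ?R * e"
    using energy noise tangent_noise overlap fW lower[folded e_def] by (simp add: algebra_simps)
  then have "((6 * \<alpha> - (sqrt 5 + 2) * \<beta>) * e) * e \<le> ?R * e"
    by (simp add: algebra_simps power2_eq_square)
  moreover have "0 \<le> ?R"
    using lam c0 by simp
  ultimately have "(6 * \<alpha> - (sqrt 5 + 2) * \<beta>) * e \<le> ?R"
    by (cases "e = 0") (simp_all add: e_def mult_le_cancel_right)
  then show ?thesis
    by (simp add: e_def k_def)
qed

section \<open>First- and second-order conditions for the two objectives\<close>

text \<open>
  Both objectives are polynomials of degree four along every line, so the gradient and the
  Hessian at a critical point can be read off as coefficients.
\<close>
lemma second_order_critical_point_along_line: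
  fixes f :: "'a::euclidean_space \<Rightarrow> real"
  assumes crit: "second_order_critical_point f x"
    and poly: "\<And>t. f (x + t *\<^sub>R h) = a0 + a1 * t + a2 * t\<^sup>2 + a3 * t ^ 3 + a4 * t ^ 4"
  shows "a1 = 0" and "0 \<le> a2"
proof -
  obtain g H where g: "\<forall>\<^sub>F z in nhds x. GDERIV f z :> g z" and H: "(g has_derivative H) (at x)"
    and gx: "g x = 0" and psd: "\<And>h. 0 \<le> h \<bullet> H h"
    using crit unfolding second_order_critical_point_def by blast
  have lim: "((\<lambda>t. x + t *\<^sub>R h) \<longlongrightarrow> x) (nhds 0)"
    using tendsto_at_iff_tendsto_nhds[of "\<lambda>t. x + t *\<^sub>R h" "0::real"]
    by (auto intro!: tendsto_eq_intros)
  have "\<forall>\<^sub>F t in nhds 0. GDERIV f (x + t *\<^sub>R h) :> g (x + t *\<^sub>R h)"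
    using eventually_compose_filterlim[OF g lim] .
  then have eq: "\<forall>\<^sub>F t in nhds 0. h \<bullet> g (x + t *\<^sub>R h) = a1 + 2 * a2 * t + 3 * a3 * t\<^sup>2 + 4 * a4 * t ^ 3"
  proof eventually_elim
    case (elim t)
    have "((\<lambda>t. x + t *\<^sub>R h) has_derivative (\<lambda>d. d *\<^sub>R h)) (at t)"
      by (auto intro!: derivative_eq_intros)
    from has_derivative_compose[OF this elim[unfolded gderiv_def]]
     have "((\<lambda>t. f (x + t *\<^sub>R h)) has_field_derivative (h \<bullet> g (x + t *\<^sub>R h))) (at t)"
      by (rule has_derivative_imp_has_field_derivative) (simp add: mult.commute)
    moreover have "((\<lambda>t. f (x + t *\<^sub>R h)) has_field_derivative (a1 + 2 * a2 * t + 3 * a3 * t\<^sup>2 + 4 * a4 * t ^ 3)) (at t)"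
      unfolding poly by (auto intro!: derivative_eq_intros simp: power2_eq_square power3_eq_cube)
    ultimately show ?case
      by (rule DERIV_unique)
  qed
  from eventually_nhds_x_imp_x[OF eq] gx show "a1 = 0"
    by simp
  have "((\<lambda>t. x + t *\<^sub>R h) has_derivative (\<lambda>d. d *\<^sub>R h)) (at 0)"
    by (auto intro!: derivative_eq_intros)
  from has_derivative_compose[OF this, of g H] H
  have "((\<lambda>t. g (x + t *\<^sub>R h)) has_derivative (\<lambda>d. H (d *\<^sub>R h))) (at 0)"
    by simp
  then have "((\<lambda>t. h \<bullet> g (x + t *\<^sub>R h)) has_derivative (\<lambda>d. h \<bullet> H (d *\<^sub>R h))) (at 0)"
    by (rule has_derivative_inner_right)
  then have "((\<lambda>t. h \<bullet> g (x + t *\<^sub>R h)) has_field_derivative (h \<bullet> H h)) (at 0)"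
    by (rule has_derivative_imp_has_field_derivative)
       (simp add: linear_scale[OF has_derivative_linear[OF H]])
  moreover have "((\<lambda>t. h \<bullet> g (x + t *\<^sub>R h)) has_field_derivative (2 * a2)) (at 0)"
  proof (subst DERIV_cong_ev[OF refl eq refl])
    show "((\<lambda>t. a1 + 2 * a2 * t + 3 * a3 * t\<^sup>2 + 4 * a4 * t ^ 3) has_field_derivative 2 * a2) (at 0)"
      by (auto intro!: derivative_eq_intros)
  qed
  ultimately have "h \<bullet> H h = 2 * a2"
    by (rule DERIV_unique)
  then show "0 \<le> a2"
    using psd[of h] by simp
qed

lemma linear_meas_op: "linear (meas_op A)"
  by (rule linearI) (simp_all add: meas_op_def vec_eq_iff inner_add_right)

lemma norm_quadratic_path:
  fixes a b c :: "'e::real_inner"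
  shows "(norm (a + t *\<^sub>R b + t\<^sup>2 *\<^sub>R c))\<^sup>2
    = (norm a)\<^sup>2 + 2 * (a \<bullet> b) * t + ((norm b)\<^sup>2 + 2 * (a \<bullet> c)) * t\<^sup>2 + 2 * (b \<bullet> c) * t ^ 3 + (norm c)\<^sup>2 * t ^ 4"
  unfolding power2_norm_eq_inner
  by (simp add: inner_simps inner_commute power2_eq_square power3_eq_cube power4_eq_xxxx algebra_simps)

lemma norm_linear_path:
  fixes a b :: "'e::real_inner"
  shows "(norm (a + t *\<^sub>R b))\<^sup>2 = (norm a)\<^sup>2 + 2 * (a \<bullet> b) * t + (norm b)\<^sup>2 * t\<^sup>2"
  using norm_quadratic_path[of a t b 0] by simp

lemma objective_critical_conditions:
  fixes A :: "'n::finite \<Rightarrow> real^'c^'b" and U :: "real^'r^'b" and V :: "real^'r^'c"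
  assumes crit: "second_order_critical_point (objective A y lam) (U, V)"
  defines "\<rho> \<equiv> meas_op A (U ** transpose V) - y"
  shows "\<rho> \<bullet> meas_op A (U ** transpose Z + Y ** transpose V) + lam * (U \<bullet> Y + V \<bullet> Z) = 0"
    and "0 \<le> (norm (meas_op A (U ** transpose Z + Y ** transpose V)))\<^sup>2
        + 2 * (\<rho> \<bullet> meas_op A (Y ** transpose Z)) + lam * ((norm Y)\<^sup>2 + (norm Z)\<^sup>2)"
proof -
  let ?b = "meas_op A (U ** transpose Z + Y ** transpose V)" and ?c = "meas_op A (Y ** transpose Z)"
  note lin = linear_add[OF linear_meas_op] linear_scale[OF linear_meas_op]
  have path: "objective A y lam ((U, V) + t *\<^sub>R (Y, Z))
      = (1/2 * (norm \<rho>)\<^sup>2 + lam * ((norm U)\<^sup>2 + (norm V)\<^sup>2) / 2)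
        + (\<rho> \<bullet> ?b + lam * (U \<bullet> Y + V \<bullet> Z)) * t
        + (((norm ?b)\<^sup>2 + 2 * (\<rho> \<bullet> ?c) + lam * ((norm Y)\<^sup>2 + (norm Z)\<^sup>2)) / 2) * t\<^sup>2
        + (?b \<bullet> ?c) * t ^ 3 + ((norm ?c)\<^sup>2 / 2) * t ^ 4" for t
  proof -
    have "(U + t *\<^sub>R Y) ** transpose (V + t *\<^sub>R Z)
        = U ** transpose V + t *\<^sub>R (U ** transpose Z + Y ** transpose V) + t\<^sup>2 *\<^sub>R (Y ** transpose Z)"
      by (simp add: matrix_distribs scaleR_add_right power2_eq_square add_ac)
    then have "meas_op A ((U + t *\<^sub>R Y) ** transpose (V + t *\<^sub>R Z)) - y = \<rho> + t *\<^sub>R ?b + t\<^sup>2 *\<^sub>R ?c"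
      by (simp add: lin \<rho>_def scaleR_add_right)
    then show ?thesis
      by (simp add: objective_def norm_quadratic_path) (simp add: norm_linear_path field_simps)
  qed
  from second_order_critical_point_along_line[OF crit path]
  show "\<rho> \<bullet> ?b + lam * (U \<bullet> Y + V \<bullet> Z) = 0"
    and "0 \<le> (norm ?b)\<^sup>2 + 2 * (\<rho> \<bullet> ?c) + lam * ((norm Y)\<^sup>2 + (norm Z)\<^sup>2)"
    by simp_all
qed

lemma objective_sym_critical_conditions:
  fixes A :: "'n::finite \<Rightarrow> real^'d^'d" and U :: "real^'r^'d"
  assumes crit: "second_order_critical_point (objective_sym A y lam) U"
  defines "\<rho> \<equiv> meas_op A (U ** transpose U) - y"
  shows "\<rho> \<bullet> meas_op A (U ** transpose Z + Z ** transpose U) + 2 * lam * (U \<bullet> Z) = 0"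
    and "0 \<le> (norm (meas_op A (U ** transpose Z + Z ** transpose U)))\<^sup>2
        + 2 * (\<rho> \<bullet> meas_op A (Z ** transpose Z)) + 2 * lam * (norm Z)\<^sup>2"
proof -
  let ?b = "meas_op A (U ** transpose Z + Z ** transpose U)" and ?c = "meas_op A (Z ** transpose Z)"
  note lin = linear_add[OF linear_meas_op] linear_scale[OF linear_meas_op]
  have path: "objective_sym A y lam (U + t *\<^sub>R Z)
      = (1/2 * (norm \<rho>)\<^sup>2 + lam * (norm U)\<^sup>2)
        + (\<rho> \<bullet> ?b + 2 * lam * (U \<bullet> Z)) * t
        + (((norm ?b)\<^sup>2 + 2 * (\<rho> \<bullet> ?c) + 2 * lam * (norm Z)\<^sup>2) / 2) * t\<^sup>2
        + (?b \<bullet> ?c) * t ^ 3 + ((norm ?c)\<^sup>2 / 2) * t ^ 4" for t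
  proof -
    have "(U + t *\<^sub>R Z) ** transpose (U + t *\<^sub>R Z)
        = U ** transpose U + t *\<^sub>R (U ** transpose Z + Z ** transpose U) + t\<^sup>2 *\<^sub>R (Z ** transpose Z)"
      by (simp add: matrix_distribs scaleR_add_right power2_eq_square add_ac)
    then have "meas_op A ((U + t *\<^sub>R Z) ** transpose (U + t *\<^sub>R Z)) - y = \<rho> + t *\<^sub>R ?b + t\<^sup>2 *\<^sub>R ?c"
      by (simp add: lin \<rho>_def scaleR_add_right)
    then show ?thesis
      by (simp add: objective_sym_def norm_quadratic_path) (simp add: norm_linear_path field_simps)
  qed
  from second_order_critical_point_along_line[OF crit path]
  show "\<rho> \<bullet> ?b + 2 * lam * (U \<bullet> Z) = 0"
    and "0 \<le> (norm ?b)\<^sup>2 + 2 * (\<rho> \<bullet> ?c) + 2 * lam * (norm Z)\<^sup>2"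
    by simp_all
qed

section \<open>Passing to a balanced critical pair\<close>

text \<open>
  First- and second-order stationarity of \<open>(U, V)\<close> for \<open>M \<mapsto> \<parallel>f M - y\<parallel>\<^sup>2 / 2\<close> with the
  regulariser, where \<open>S\<close> is the gradient of that data term at \<open>U V\<^sup>T\<close>. As \<open>S\<close> depends on the
  product alone, it can be kept fixed when the factors are changed.
\<close>
definition factor_critical ::
  "(real^'b^'a \<Rightarrow> 'e::real_inner) \<Rightarrow> real^'b^'a \<Rightarrow> real \<Rightarrow> real^'r^'a \<Rightarrow> real^'r^'b \<Rightarrow> bool" where
  "factor_critical f S lam U V \<longleftrightarrow>
     (\<forall>Y Z. S \<bullet> (U ** transpose Z + Y ** transpose V) + lam * (U \<bullet> Y + V \<bullet> Z) = 0) \<and>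
     (\<forall>Y Z. 0 \<le> (norm (f (U ** transpose Z + Y ** transpose V)))\<^sup>2
        + 2 * (S \<bullet> (Y ** transpose Z)) + lam * ((norm Y)\<^sup>2 + (norm Z)\<^sup>2))"

lemma inner_mult_gram: "Y \<bullet> (Y ** K) = K \<bullet> (transpose Y ** Y)" for Y :: "real^'r^'m"
  using inner_mult_left[of Y K Y] by (simp add: inner_commute)

text \<open>
  Test the gradient with \<open>(U K, - V K)\<close>, \<open>K = U\<^sup>T U - V\<^sup>T V\<close>: to first order \<open>U V\<^sup>T\<close> does not
  change, so only the regulariser is left, and its derivative is \<open>lam \<parallel>K\<parallel>\<^sup>2\<close>.
\<close>
lemma factor_critical_balanced:
  fixes U :: "real^'r^'a" and V :: "real^'r^'b"
  assumes "factor_critical f S lam U V" and "lam \<noteq> 0"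
  shows "transpose U ** U = transpose V ** V"
proof -
  define K where "K = transpose U ** U - transpose V ** V"
  have K_sym: "transpose K = K"
    by (simp add: K_def matrix_distribs)
  have "U ** transpose (- (V ** K)) + (U ** K) ** transpose V = 0"
  proof -
    have "transpose (- N) = - transpose N" "U ** - N' = - (U ** N')" for N :: "real^'r^'b" and N' :: "real^'b^'r"
      by (simp_all add: transpose_def matrix_matrix_mult_def vec_eq_iff sum_negf)
    then show ?thesis
      by (simp add: matrix_transpose_mul K_sym matrix_mul_assoc)
  qed
  then have "lam * (U \<bullet> (U ** K) + V \<bullet> (- (V ** K))) = 0"
    using assms(1) unfolding factor_critical_def by (metis add_0 inner_zero_right)
  then have "U \<bullet> (U ** K) - V \<bullet> (V ** K) = 0"
    using assms(2) by simp
  then have "K \<bullet> (transpose U ** U - transpose V ** V) = 0"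
    by (simp add: inner_diff_right inner_mult_gram)
  then have "K \<bullet> K = 0"
    unfolding K_def[symmetric] .
  then show ?thesis
    by (simp add: K_def)
qed

lemma nonneg_quadratic_imp_linear_zero:
  fixes b :: real
  assumes "\<And>t. 0 \<le> a * t\<^sup>2 + b * t"
  shows "b = 0"
proof (rule ccontr)
  assume "b \<noteq> 0"
  define d where "d = \<bar>a\<bar> + 1"
  define t where "t = - b / (2 * d)"
  have d: "0 < d" by (simp add: d_def)
  then have b: "b = - 2 * d * t" and "t \<noteq> 0"
    using \<open>b \<noteq> 0\<close> by (simp_all add: t_def)
  have "0 \<le> a * t\<^sup>2 + b * t" by (rule assms)
  also have "\<dots> \<le> d * t\<^sup>2 + b * t"
    using mult_right_mono[of a d "t\<^sup>2"] by (simp add: d_def)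
  also have "\<dots> = - (d * t\<^sup>2)"
    by (simp add: b power2_eq_square)
  also have "\<dots> < 0"
    using d \<open>t \<noteq> 0\<close> by simp
  finally show False by simp
qed

text \<open>
  Along directions \<open>y p\<^sup>T\<close>, \<open>z p\<^sup>T\<close> with \<open>p\<close> in the kernel of one factor, scaling the direction
  of that factor by \<open>t\<close> makes the Hessian a quadratic polynomial in \<open>t\<close> without constant term
  whose linear coefficient is a multiple of \<open>\<langle>S, y z\<^sup>T\<rangle>\<close>.
\<close>
lemma factor_critical_degenerate:
  fixes U :: "real^'r^'a" and V :: "real^'r^'b"
  assumes crit: "factor_critical f S 0 U V" and f: "linear f"
    and p: "p \<noteq> 0" "U *v p = 0 \<or> V *v p = 0"
  shows "S = 0"
proof -
  have pp: "p \<bullet> p \<noteq> 0" using p by simp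
  have vanish: "S \<bullet> outer_prod y z = 0" for y z
  proof -
    have "0 \<le> (norm (f (outer_prod (U *v p) z + outer_prod y (V *v p))))\<^sup>2 * t\<^sup>2
        + (2 * (p \<bullet> p) * (S \<bullet> outer_prod y z)) * t" for t
    proof -
      have hess: "0 \<le> (norm (f (U ** transpose Z + Y ** transpose V)))\<^sup>2 + 2 * (S \<bullet> (Y ** transpose Z))" for Y Z
        using crit unfolding factor_critical_def by simp
      have f0: "f 0 = 0" and fs: "f (c *\<^sub>R N) = c *\<^sub>R f N" for c N
        using f by (simp_all add: linear_0 linear_scale)
      have prod: "outer_prod y p ** outer_prod p z = (p \<bullet> p) *\<^sub>R outer_prod y z"
        by (simp add: mult_outer_prod outer_prod_mult_vector) (simp add: outer_prod_def vec_eq_iff)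
      have row: "outer_prod y p ** transpose V = outer_prod y (V *v p)"
        by (metis matrix_transpose_mul mult_outer_prod transpose_outer_prod transpose_transpose)
      have zero: "outer_prod 0 z = 0" "outer_prod y 0 = 0"
        by (simp_all add: outer_prod_def vec_eq_iff)
      from p(2) show ?thesis
      proof
        assume "U *v p = 0"
        then show ?thesis
          using hess[of "outer_prod z p" "t *\<^sub>R outer_prod y p"]
          by (simp add: matrix_distribs transpose_outer_prod mult_outer_prod[of U] row zero fs prod power_mult_distrib mult_ac)
      next
        assume "V *v p = 0"
        then show ?thesis
          using hess[of "t *\<^sub>R outer_prod z p" "outer_prod y p"]
          by (simp add: matrix_distribs transpose_outer_prod mult_outer_prod[of U] row zero fs prod power_mult_distrib mult_ac)
      qed
    qed
    from nonneg_quadratic_imp_linear_zero[OF this] pp show ?thesis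
      by simp
  qed
  have "S *v z = 0" for z
    using vanish[of "S *v z" z] by (simp add: inner_outer_prod)
  then show ?thesis
    by (simp add: matrix_eq)
qed

text \<open>
  For \<open>lam = 0\<close> and injective factors, two factorisations of the same matrix differ by an
  invertible change of basis \<open>(G, H)\<close> with \<open>G H\<^sup>T = I\<close>, under which the stationarity conditions
  are invariant. If a factor is not injective then \<open>S = 0\<close>, and every pair is stationary.
\<close>
lemma ex_balanced_factor_critical:
  fixes U :: "real^'r^'a" and V :: "real^'r^'b"
  assumes crit: "factor_critical f S lam U V" and f: "linear f"
  obtains U' :: "real^'r^'a" and V' :: "real^'r^'b"
  where "U' ** transpose V' = U ** transpose V" "transpose U' ** U' = transpose V' ** V'"
    "factor_critical f S lam U' V'"
proof (cases "lam = 0")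
  case False
  then show thesis
    using that[of U V] factor_critical_balanced[OF crit] crit by blast
next
  case lam: True
  let ?M = "U ** transpose V"
  have "rank ?M \<le> CARD('r)"
    using rank_mul_le_left[of U "transpose V"] rank_bound[of U] by simp
  then obtain U' :: "real^'r^'a" and V' :: "real^'r^'b"
    where prod: "U' ** transpose V' = ?M" and bal: "transpose U' ** U' = transpose V' ** V'"
    by (rule ex_balanced_factorization)
  have "factor_critical f S lam U' V'"
  proof (cases "inj ((*v) U) \<and> inj ((*v) V)")
    case False
    then have "(\<exists>p. p \<noteq> 0 \<and> U *v p = 0) \<or> (\<exists>p. p \<noteq> 0 \<and> V *v p = 0)"
      by (metis full_rank_injective matrix_nonfull_linear_equations_eq)
    then have "S = 0"
      using factor_critical_degenerate[OF crit[unfolded lam] f] by blast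
    then show ?thesis
      by (simp add: factor_critical_def lam)
  next
    case True
    then obtain L L' where L: "L ** U = mat 1" "L' ** V = mat 1"
      by (metis matrix_left_invertible_injective)
    obtain K where "U' = U' ** transpose V' ** K"
      using balanced_factor_left[OF bal] .
    then obtain G where G: "U' = U ** G"
      by (metis prod matrix_mul_assoc)
    obtain K' where "transpose V' = K' ** (U' ** transpose V')"
      using balanced_factor_right[OF bal] .
    then have "V' = V ** transpose (K' ** U)"
      by (metis prod matrix_mul_assoc matrix_transpose_mul transpose_transpose)
    then obtain H where H: "V' = V ** H" by blast
    have "L ** (U ** G ** transpose H ** transpose V) ** transpose L' = L ** (U ** transpose V) ** transpose L'"
      using prod by (simp add: G H matrix_transpose_mul matrix_mul_assoc)
    moreover have "transpose V ** transpose L' = mat 1"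
      by (metis L(2) matrix_transpose_mul transpose_mat)
    ultimately have "G ** transpose H = mat 1"
      using L(1) by (metis matrix_mul_assoc matrix_mul_lid matrix_mul_rid)
    then have HG: "transpose H ** G = mat 1"
      by (metis matrix_left_right_inverse)
    have "U' ** transpose Z + Y ** transpose V'
        = U ** transpose (Z ** transpose G) + (Y ** transpose H) ** transpose V" for Y Z
      by (simp add: G H matrix_transpose_mul matrix_mul_assoc)
    moreover have "Y ** transpose Z = (Y ** transpose H) ** transpose (Z ** transpose G)" for Y Z
      using HG by (simp add: matrix_transpose_mul) (metis matrix_mul_assoc matrix_mul_rid)
    ultimately show ?thesis
      using crit unfolding factor_critical_def lam by (metis (no_types, lifting) mult_zero_left)
  qed
  with prod bal show thesis
    by (rule that)
qed

lemma ex_aligned_balanced_factorization: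
  fixes M :: "real^'b^'a" and U :: "real^'r^'a" and V :: "real^'r^'b"
  assumes "rank M \<le> CARD('r)"
  obtains D1 :: "real^'r^'a" and D2 :: "real^'r^'b"
  where "D1 ** transpose D2 = M" "transpose D1 ** D1 = transpose D2 ** D2"
    "transpose (transpose U ** D1 + transpose V ** D2) = transpose U ** D1 + transpose V ** D2"
    "\<And>v. 0 \<le> v \<bullet> ((transpose U ** D1 + transpose V ** D2) *v v)"
proof -
  obtain F1 :: "real^'r^'a" and F2 :: "real^'r^'b"
    where F: "F1 ** transpose F2 = M" "transpose F1 ** F1 = transpose F2 ** F2"
    using ex_balanced_factorization[OF assms] .
  obtain Q where Q: "Q ** transpose Q = mat 1"
      "transpose ((transpose U ** F1 + transpose V ** F2) ** Q) = (transpose U ** F1 + transpose V ** F2) ** Q"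
      "\<And>v. 0 \<le> v \<bullet> (((transpose U ** F1 + transpose V ** F2) ** Q) *v v)"
    using polar_decomposition[of "transpose U ** F1 + transpose V ** F2"] by blast
  have "(F1 ** Q) ** transpose (F2 ** Q) = F1 ** (Q ** transpose Q) ** transpose F2"
    by (simp add: matrix_transpose_mul matrix_mul_assoc)
  then have prod: "(F1 ** Q) ** transpose (F2 ** Q) = M"
    by (simp add: Q(1) F(1))
  have "transpose (F1 ** Q) ** (F1 ** Q) = transpose Q ** (transpose F1 ** F1) ** Q"
    by (simp add: matrix_transpose_mul matrix_mul_assoc)
  also have "\<dots> = transpose (F2 ** Q) ** (F2 ** Q)"
    unfolding F(2) by (simp add: matrix_transpose_mul matrix_mul_assoc)
  finally show thesis
    using that[of "F1 ** Q" "F2 ** Q"] prod Q(2,3)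
    by (simp add: matrix_add_rdistrib matrix_mul_assoc)
qed

section \<open>The two recovery theorems\<close>

lemma asymmetric_error_bound:
  fixes A :: "'n::finite \<Rightarrow> real^'c^'b" and M\<^sub>0 :: "real^'c^'b" and U :: "real^'r^'b" and V :: "real^'r^'c"
  assumes lam: "0 \<le> lam" and \<beta>: "0 \<le> \<beta>"
    and y: "y = meas_op A M\<^sub>0 + \<xi>" and rank: "rank M\<^sub>0 \<le> CARD('r)"
    and lower: "\<And>M. rank M \<le> CARD('r) \<Longrightarrow> \<alpha> * (norm (M - M\<^sub>0))\<^sup>2 \<le> (norm (meas_op A (M - M\<^sub>0)))\<^sup>2"
    and upper: "\<And>H. H \<in> tangent_space M\<^sub>0 \<Longrightarrow> (norm (meas_op A H))\<^sup>2 \<le> \<beta> * (norm H)\<^sup>2"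
    and crit: "second_order_critical_point (objective A y lam) (U, V)"
  defines "c \<equiv> op_norm (adjoint (meas_op A) \<xi>)"
  shows "(6 * \<alpha> - (sqrt 5 + 2) * \<beta>) * norm (U ** transpose V - M\<^sub>0)
      \<le> (36 * lam + 12 * c) * sqrt (real (rank M\<^sub>0)) + 10 * sqrt (real (CARD('r) + rank M\<^sub>0)) * max (c - lam) 0"
proof -
  let ?f = "meas_op A"
  define \<Xi> where "\<Xi> = adjoint ?f \<xi>"
  define S where "S = adjoint ?f (?f (U ** transpose V - M\<^sub>0) - \<xi>)"
  have adj: "v \<bullet> ?f N = adjoint ?f v \<bullet> N" for v N
    using adjoint_works[OF linear_meas_op, of N A v] by (simp add: inner_commute)
  have residual: "?f (U ** transpose V) - y = ?f (U ** transpose V - M\<^sub>0) - \<xi>"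
    by (simp add: y linear_diff[OF linear_meas_op])
  have "factor_critical ?f S lam U V"
    unfolding factor_critical_def S_def adj[symmetric] residual[symmetric]
    using objective_critical_conditions[OF crit] by blast
  then obtain U' :: "real^'r^'b" and V' :: "real^'r^'c"
    where prod: "U' ** transpose V' = U ** transpose V" and bal: "transpose U' ** U' = transpose V' ** V'"
      and crit': "factor_critical ?f S lam U' V'"
    using ex_balanced_factor_critical[OF _ linear_meas_op] by blast
  obtain D1 :: "real^'r^'b" and D2 :: "real^'r^'c"
    where D: "D1 ** transpose D2 = M\<^sub>0" "transpose D1 ** D1 = transpose D2 ** D2"
      "transpose (transpose U' ** D1 + transpose V' ** D2) = transpose U' ** D1 + transpose V' ** D2"
      "\<And>v. 0 \<le> v \<bullet> ((transpose U' ** D1 + transpose V' ** D2) *v v)"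
    using ex_aligned_balanced_factorization[OF rank, of U' V'] by blast
  have S: "(?f (U' ** transpose V' - D1 ** transpose D2) - \<xi>) \<bullet> ?f N = S \<bullet> N" for N
    by (simp add: prod D(1) S_def adj)
  have first: "S \<bullet> (U' ** transpose Z + Y ** transpose V') + lam * (U' \<bullet> Y + V' \<bullet> Z) = 0"
    and second: "0 \<le> (norm (?f (U' ** transpose Z + Y ** transpose V')))\<^sup>2
        + 2 * (S \<bullet> (Y ** transpose Z)) + lam * ((norm Y)\<^sup>2 + (norm Z)\<^sup>2)" for Y Z
    using crit' unfolding factor_critical_def by blast+
  have tangent: "U' ** transpose D2 + D1 ** transpose V' - 2 *\<^sub>R M\<^sub>0 \<in> tangent_space M\<^sub>0"
  proof -
    obtain K1 where K1: "D1 = M\<^sub>0 ** K1"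
      using balanced_factor_left[OF D(2)] D(1) by metis
    obtain K2 where K2: "transpose D2 = K2 ** M\<^sub>0"
      using balanced_factor_right[OF D(2)] D(1) by metis
    have "U' ** transpose D2 + D1 ** transpose V' - 2 *\<^sub>R M\<^sub>0
        = (U' ** K2 - 2 *\<^sub>R mat 1) ** M\<^sub>0 + M\<^sub>0 ** transpose (V' ** transpose K1)"
      unfolding K1 K2 by (simp add: matrix_distribs matrix_mul_assoc)
    then show ?thesis
      unfolding tangent_space_def by blast
  qed
  have "(6 * \<alpha> - (sqrt 5 + 2) * \<beta>) * norm (U' ** transpose V' - D1 ** transpose D2)
      \<le> (36 * lam + 12 * c) * sqrt (real (rank (D1 ** transpose D2)))
        + 10 * sqrt (real (CARD('r) + rank (D1 ** transpose D2))) * max (c - lam) 0"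
  proof (rule critical_point_error_bound[OF linear_meas_op adj[of \<xi>] _ lam \<beta> bal D(2,3,4), unfolded S])
    show "norm (adjoint ?f \<xi> *v x) \<le> c * norm x" for x
      unfolding c_def op_norm_def by (rule onorm) simp
    show "S \<bullet> (U' ** transpose D2 + D1 ** transpose V') + lam * (U' \<bullet> D1 + V' \<bullet> D2) = 0"
      by (rule first)
    show "2 * (S \<bullet> (U' ** transpose V')) + lam * ((norm U')\<^sup>2 + (norm V')\<^sup>2) = 0"
      using first[of V' U'] by (simp only: inner_add_right power2_norm_eq_inner mult_2)
    show "0 \<le> (norm (?f (U' ** transpose (D2 - V') + (D1 - U') ** transpose V')))\<^sup>2
        + 2 * (S \<bullet> ((D1 - U') ** transpose (D2 - V'))) + lam * ((norm (D1 - U'))\<^sup>2 + (norm (D2 - V'))\<^sup>2)"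
      by (rule second)
    show "\<alpha> * (norm (U' ** transpose V' - D1 ** transpose D2))\<^sup>2 \<le> (norm (?f (U' ** transpose V' - D1 ** transpose D2)))\<^sup>2"
      unfolding D(1) using rank_mul_le_left[of U' "transpose V'"] rank_bound[of U'] by (intro lower) simp
    show "(norm (?f (U' ** transpose D2 + D1 ** transpose V' - 2 *\<^sub>R (D1 ** transpose D2))))\<^sup>2
        \<le> \<beta> * (norm (U' ** transpose D2 + D1 ** transpose V' - 2 *\<^sub>R (D1 ** transpose D2)))\<^sup>2"
      unfolding D(1) by (rule upper[OF tangent])
  qed
  then show ?thesis
    by (simp only: D(1) prod)
qed

lemma symmetric_error_bound:
  fixes A :: "'n::finite \<Rightarrow> real^'d^'d" and M\<^sub>0 :: "real^'d^'d" and U :: "real^'r^'d"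
  assumes lam: "0 \<le> lam" and \<beta>: "0 \<le> \<beta>" and M0: "M\<^sub>0 \<in> psd_matrices"
    and y: "y = meas_op A M\<^sub>0 + \<xi>" and rank: "rank M\<^sub>0 \<le> CARD('r)"
    and lower: "\<And>M. M \<in> psd_matrices \<Longrightarrow> rank M \<le> CARD('r) \<Longrightarrow>
        \<alpha> * (norm (M - M\<^sub>0))\<^sup>2 \<le> (norm (meas_op A (M - M\<^sub>0)))\<^sup>2"
    and upper: "\<And>H. H \<in> tangent_space_sym M\<^sub>0 \<Longrightarrow> (norm (meas_op A H))\<^sup>2 \<le> \<beta> * (norm H)\<^sup>2"
    and crit: "second_order_critical_point (objective_sym A y lam) U"
  defines "c \<equiv> op_norm (adjoint (meas_op A) \<xi>)"
  shows "(6 * \<alpha> - (sqrt 5 + 2) * \<beta>) * norm (U ** transpose U - M\<^sub>0)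
      \<le> (36 * lam + 12 * c) * sqrt (real (rank M\<^sub>0)) + 10 * sqrt (real (CARD('r) + rank M\<^sub>0)) * max (c - lam) 0"
proof -
  let ?f = "meas_op A"
  define S where "S = adjoint ?f (?f (U ** transpose U - M\<^sub>0) - \<xi>)"
  have adj: "v \<bullet> ?f N = adjoint ?f v \<bullet> N" for v N
    using adjoint_works[OF linear_meas_op, of N A v] by (simp add: inner_commute)
  have residual: "?f (U ** transpose U) - y = ?f (U ** transpose U - M\<^sub>0) - \<xi>"
    by (simp add: y linear_diff[OF linear_meas_op])
  obtain F :: "real^'r^'d" where F: "F ** transpose F = M\<^sub>0"
    using ex_psd_factorization[OF M0 rank] .
  obtain Q where Q: "Q ** transpose Q = mat 1" "transpose (transpose U ** F ** Q) = transpose U ** F ** Q"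
      "\<And>v. 0 \<le> v \<bullet> ((transpose U ** F ** Q) *v v)"
    using polar_decomposition[of "transpose U ** F"] by blast
  define D where "D = F ** Q"
  have "D ** transpose D = F ** (Q ** transpose Q) ** transpose F"
    by (simp add: D_def matrix_transpose_mul matrix_mul_assoc)
  then have D: "D ** transpose D = M\<^sub>0"
    by (simp add: Q(1) F)
  have UD: "transpose (transpose U ** D + transpose U ** D) = transpose U ** D + transpose U ** D"
    "\<And>v. 0 \<le> v \<bullet> ((transpose U ** D + transpose U ** D) *v v)"
  proof -
    have "transpose (transpose U ** D) = transpose U ** D" "\<And>v. 0 \<le> v \<bullet> ((transpose U ** D) *v v)"
      using Q(2,3) by (simp_all add: D_def matrix_mul_assoc)
    then show "transpose (transpose U ** D + transpose U ** D) = transpose U ** D + transpose U ** D"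
      "\<And>v. 0 \<le> v \<bullet> ((transpose U ** D + transpose U ** D) *v v)"
      by (simp_all only: transpose_add matrix_vector_mult_add_rdistrib inner_add_right add_nonneg_nonneg)
  qed
  have S: "(?f (U ** transpose U - D ** transpose D) - \<xi>) \<bullet> ?f N = S \<bullet> N" for N
    by (simp add: D S_def adj)
  have first: "S \<bullet> (U ** transpose Z + Z ** transpose U) + 2 * lam * (U \<bullet> Z) = 0"
    and second: "0 \<le> (norm (?f (U ** transpose Z + Z ** transpose U)))\<^sup>2
        + 2 * (S \<bullet> (Z ** transpose Z)) + 2 * lam * (norm Z)\<^sup>2" for Z
    using objective_sym_critical_conditions[OF crit, of Z] by (simp_all only: S_def residual adj)
  have M_psd: "U ** transpose U \<in> psd_matrices"
    using gram_quadratic_form[of _ "transpose U"] by (simp add: psd_matrices_def matrix_transpose_mul)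
  have tangent: "U ** transpose D + D ** transpose U - 2 *\<^sub>R M\<^sub>0 \<in> tangent_space_sym M\<^sub>0"
  proof -
    have M0_sym: "transpose M\<^sub>0 = M\<^sub>0"
      using M0 by (simp add: psd_matrices_def)
    obtain K where K: "D = M\<^sub>0 ** K"
      using balanced_factor_left[of D D] D by metis
    have "U ** transpose D + D ** transpose U - 2 *\<^sub>R M\<^sub>0
        = (U ** transpose K - mat 1) ** M\<^sub>0 + M\<^sub>0 ** transpose (U ** transpose K - mat 1)"
      unfolding K by (simp add: matrix_distribs matrix_mul_assoc M0_sym scaleR_2)
    then show ?thesis
      unfolding tangent_space_sym_def by blast
  qed
  have "(6 * \<alpha> - (sqrt 5 + 2) * \<beta>) * norm (U ** transpose U - D ** transpose D)
      \<le> (36 * lam + 12 * c) * sqrt (real (rank (D ** transpose D)))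
        + 10 * sqrt (real (CARD('r) + rank (D ** transpose D))) * max (c - lam) 0"
  proof (rule critical_point_error_bound[OF linear_meas_op adj[of \<xi>] _ lam \<beta> refl refl UD, unfolded S])
    show "norm (adjoint ?f \<xi> *v x) \<le> c * norm x" for x
      unfolding c_def op_norm_def by (rule onorm) simp
    show "S \<bullet> (U ** transpose D + D ** transpose U) + lam * (U \<bullet> D + U \<bullet> D) = 0"
      using first[of D] by simp
    show "2 * (S \<bullet> (U ** transpose U)) + lam * ((norm U)\<^sup>2 + (norm U)\<^sup>2) = 0"
      using first[of U] by (simp only: inner_add_right power2_norm_eq_inner mult_2 distrib_left distrib_right)
    show "0 \<le> (norm (?f (U ** transpose (D - U) + (D - U) ** transpose U)))\<^sup>2
        + 2 * (S \<bullet> ((D - U) ** transpose (D - U))) + lam * ((norm (D - U))\<^sup>2 + (norm (D - U))\<^sup>2)"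
      using second[of "D - U"] by simp
    show "\<alpha> * (norm (U ** transpose U - D ** transpose D))\<^sup>2 \<le> (norm (?f (U ** transpose U - D ** transpose D)))\<^sup>2"
      unfolding D using rank_mul_le_left[of U "transpose U"] rank_bound[of U] by (intro lower M_psd) simp
    show "(norm (?f (U ** transpose D + D ** transpose U - 2 *\<^sub>R (D ** transpose D))))\<^sup>2
        \<le> \<beta> * (norm (U ** transpose D + D ** transpose U - 2 *\<^sub>R (D ** transpose D)))\<^sup>2"
      unfolding D by (rule upper[OF tangent])
  qed
  then show ?thesis
    by (simp only: D)
qed

theorem theorem1p1:
  fixes \<alpha> \<beta> lam :: real and \<xi> y :: "real^'n"
  assumes "0 < \<alpha>" and "\<alpha> \<le> \<beta>"
    and "\<beta> / \<alpha> < 6 / (sqrt 5 + 2)"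
    and "0 \<le> lam"
  shows
    "(\<forall>(A :: 'n \<Rightarrow> real^'d2^'d1) (Mstar :: real^'d2^'d1) (U :: real^'r^'d1) (V :: real^'r^'d2).
        y = meas_op A Mstar + \<xi> \<longrightarrow>
        rank Mstar \<le> CARD('r) \<longrightarrow>
        (\<forall>M :: real^'d2^'d1. rank M \<le> CARD('r) \<longrightarrow>
           (norm (meas_op A (M - Mstar)))\<^sup>2 \<ge> \<alpha> * (norm (M - Mstar))\<^sup>2) \<longrightarrow>
        (\<forall>H \<in> tangent_space Mstar. (norm (meas_op A H))\<^sup>2 \<le> \<beta> * (norm H)\<^sup>2) \<longrightarrow>
        second_order_critical_point (objective A y lam) (U, V) \<longrightarrow>
        norm (U ** transpose V - Mstar) \<le>
          ((36 * lam + 12 * op_norm (adjoint (meas_op A) \<xi>)) * sqrt (real (rank Mstar))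
             + 10 * sqrt (real (CARD('r) + rank Mstar))
                  * max (op_norm (adjoint (meas_op A) \<xi>) - lam) 0)
          / (6 * \<alpha> - (sqrt 5 + 2) * \<beta>))
     \<and>
     (\<forall>(A :: 'n \<Rightarrow> real^'d^'d) (Mstar :: real^'d^'d) (U :: real^'r^'d).
        Mstar \<in> psd_matrices \<longrightarrow>
        (\<forall>i. transpose (A i) = A i) \<longrightarrow>
        y = meas_op A Mstar + \<xi> \<longrightarrow>
        rank Mstar \<le> CARD('r) \<longrightarrow>
        (\<forall>M \<in> psd_matrices. rank M \<le> CARD('r) \<longrightarrow>
           (norm (meas_op A (M - Mstar)))\<^sup>2 \<ge> \<alpha> * (norm (M - Mstar))\<^sup>2) \<longrightarrow>
        (\<forall>H \<in> tangent_space_sym Mstar. (norm (meas_op A H))\<^sup>2 \<le> \<beta> * (norm H)\<^sup>2) \<longrightarrow>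
        second_order_critical_point (objective_sym A y lam) U \<longrightarrow>
        norm (U ** transpose U - Mstar) \<le>
          ((36 * lam + 12 * op_norm (adjoint (meas_op A) \<xi>)) * sqrt (real (rank Mstar))
             + 10 * sqrt (real (CARD('r) + rank Mstar))
                  * max (op_norm (adjoint (meas_op A) \<xi>) - lam) 0)
          / (6 * \<alpha> - (sqrt 5 + 2) * \<beta>))"
proof -
  have "6 * \<alpha> - (sqrt 5 + 2) * \<beta> > 0"
  proof -
    have "0 < sqrt 5 + 2"
      by (simp add: add_nonneg_pos)
    then show ?thesis
      using assms(1,3) by (simp add: field_simps)
  qed
  then have divide: "e \<le> b / (6 * \<alpha> - (sqrt 5 + 2) * \<beta>)" if "(6 * \<alpha> - (sqrt 5 + 2) * \<beta>) * e \<le> b" for e b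
    using that by (simp add: pos_le_divide_eq mult.commute)
  have \<beta>: "0 \<le> \<beta>"
    using assms(1,2) by simp
  show ?thesis
    by (intro conjI allI impI divide asymmetric_error_bound[OF assms(4) \<beta>] symmetric_error_bound[OF assms(4) \<beta>]) auto
qed

end
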